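(* Let $[a,b]$ be a real interval and let $\varphi\in C^1[a,b]$ be a monotonic function. For $\alpha,\beta\in\mathbb{C}$ with $\operatorname{Re}(\alpha)>0$, $\operatorname{Re}(\beta)>0$, let $\mathcal{A}(x)=\sum_{n=0}^\infty a_nx^n$ be analytic on a complex disc $\mathcal{D}(0,R)$ with $R>(b-a)^{\operatorname{Re}(\beta)}$, where the coefficients $a_n=a_n(\alpha,\beta)$ may depend on $\alpha,\beta$. Then the equality $${}^{\mathcal{A}}_{a}I^{\alpha,\beta}_{\varphi(x)}\circ{}^{\mathcal{A}}_{a}I^{\gamma,\beta}_{\varphi(x)}u(x)={}^{\mathcal{A}}_{a}I^{\alpha+\gamma,\beta}_{\varphi(x)}u(x)$$ is uniformly valid (i.e., for all $\alpha,\beta,\gamma,u$) if and only if the condition below is satisfied for any non-negative integer $k$: $$a_k(\alpha+\gamma,\beta)\,\Gamma(\beta k+\alpha+\gamma)=\sum_{m+n=k}a_n(\alpha,\beta)\,a_m(\gamma,\beta)\,\Gamma(\beta n+\alpha)\,\Gamma(\beta m+\gamma).$$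
   Context: Here $\alpha,\beta,\gamma$ range over complex numbers with positive real part, $u$ ranges over $L^1_\varphi[a,b]$, and $m,n$ in the sum are non-negative integers. $L^1_\varphi[a,b]$ is the space of Lebesgue measurable $u:[a,b]\to\mathbb{C}$ with $\int_a^b|u(x)|\varphi'(x)\,dx<\infty$. The generalised fractional integral of $u$ with analytic kernel $\mathcal{A}$ with respect to $\varphi$ is $${}^{\mathcal{A}}_{a}I^{\alpha,\beta}_{\varphi(x)}u(x)=\int_a^x\varphi'(t)\,[\varphi(x)-\varphi(t)]^{\alpha-1}\,\mathcal{A}\big([\varphi(x)-\varphi(t)]^{\beta}\big)\,u(t)\,dt ,$$ where $\mathcal{A}$ is taken with the coefficients belonging to the parameters of the operator.
   Formalization: Added: φ is not constant (else all operators vanish and "only if" fails), and [φ(x)−φ(t)]^β lies in D(0,R) for a≤t≤x≤b, which R>(b−a)^{Re β} alone does not ensure; equality is almost everywhere with respect to |φ'(x)|dx. *)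

theory Defs
  imports "HOL-Analysis.Analysis"
begin

text \<open>
  Throughout, \<open>\<phi>'\<close> is the derivative of a monotonic C1 function \<open>\<phi>\<close> on \<open>{a..b}\<close>.
  If \<open>\<phi>\<close> is decreasing then \<open>\<phi>' \<le> 0\<close>, and the finiteness of the weighted integral in the
  next definition is absolute (equivalently, it is the condition with weight \<open>\<bar>\<phi>'\<bar>\<close>).
\<close>

definition L1_weighted :: "real \<Rightarrow> real \<Rightarrow> (real \<Rightarrow> real) \<Rightarrow> (real \<Rightarrow> complex) set" where
  "L1_weighted a b \<phi>' =
     {u. u \<in> borel_measurable (lebesgue_on {a..b}) \<and>
         integrable (lebesgue_on {a..b}) (\<lambda>x. norm (u x) * \<phi>' x)}"

text \<open>
  Equality of elements of the weighted space: almost everywhere with respect to the measure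
  \<open>\<bar>\<phi>'(x)\<bar> dx\<close>.  Where \<open>\<phi>'\<close> has no zeros on a set of positive measure this is equality almost
  everywhere.  On a set where \<open>\<phi>'\<close> vanishes (for example an interval on which \<open>\<phi>\<close> is constant,
  which \<open>\<phi>\<close> maps to a single point) the integrals defining the operators may diverge.
\<close>

definition L1_weighted_eq ::
  "real \<Rightarrow> real \<Rightarrow> (real \<Rightarrow> real) \<Rightarrow> (real \<Rightarrow> complex) \<Rightarrow> (real \<Rightarrow> complex) \<Rightarrow> bool" where
  "L1_weighted_eq a b \<phi>' f g \<longleftrightarrow>
     (AE x in lebesgue_on {a..b}. \<phi>' x \<noteq> 0 \<longrightarrow> f x = g x)"

text \<open>
  The kernel \<open>\<A> \<alpha> \<beta>\<close> is the analytic function whose coefficients belong to the parameters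
  \<open>\<alpha>, \<beta>\<close> of the operator.  Complex powers take the principal branch, which matters only when
  \<open>\<phi>\<close> is decreasing, so that \<open>\<phi> x - \<phi> t \<le> 0\<close>.
\<close>

definition analytic_kernel_integral ::
  "(complex \<Rightarrow> complex \<Rightarrow> complex \<Rightarrow> complex) \<Rightarrow> real \<Rightarrow> (real \<Rightarrow> real) \<Rightarrow> (real \<Rightarrow> real) \<Rightarrow>
   complex \<Rightarrow> complex \<Rightarrow> (real \<Rightarrow> complex) \<Rightarrow> real \<Rightarrow> complex" where
  "analytic_kernel_integral \<A> a \<phi> \<phi>' \<alpha> \<beta> u x =
     (LINT t:{a..x}|lebesgue.
        complex_of_real (\<phi>' t) * complex_of_real (\<phi> x - \<phi> t) powr (\<alpha> - 1)
          * \<A> \<alpha> \<beta> (complex_of_real (\<phi> x - \<phi> t) powr \<beta>) * u t)"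

end

theory Submission
  imports Defs
begin

text \<open>
  After replacing \<open>\<phi>\<close> by an antiderivative \<open>g\<close> of \<open>\<bar>\<phi>'\<bar>\<close> on the whole line, the operator is
  \<open>u \<mapsto> \<integral> \<kappa> (g x - g t) u(t) d\<mu>(t)\<close> with \<open>d\<mu> = g' dt\<close> on \<open>[a, b]\<close> and
  \<open>\<kappa>(r) = \<Sum> a\<^sub>n r powr (\<beta> n + \<alpha> - 1)\<close> for \<open>r > 0\<close>. Since \<open>g\<close> maps \<open>\<mu>\<close> to Lebesgue measure, Fubini turns the composition
  of two operators into the operator whose kernel is the convolution of the two kernels, and by the
  Cauchy product and the Beta integral this is again such a series, with exponent \<open>\<alpha> + \<gamma>\<close> and
  coefficients \<open>\<Sum> a\<^sub>n b\<^sub>m Beta (\<beta> n + \<alpha>) (\<beta> m + \<gamma>)\<close>. The coefficient condition says that it is the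
  kernel for \<open>\<alpha> + \<gamma>\<close>. Conversely, applying both sides to \<open>u = 1\<close> gives series in \<open>r powr \<beta>\<close>, where
  \<open>r = g x - g a\<close>, that agree for arbitrarily small \<open>r > 0\<close>, so their coefficients agree.
\<close>

section \<open>Powers on the positive half-line and the Beta integral\<close>

text \<open>
  Vanishing off the positive half-line, also where \<open>powr\<close> takes nonzero values on negative numbers,
  makes the convolution on \<open>[0, r]\<close> an integral over the whole line.
\<close>

definition pos_powr :: "complex \<Rightarrow> real \<Rightarrow> complex" where
  "pos_powr z r = (if r > 0 then exp (z * of_real (ln r)) else 0)"

lemma pos_powr_nonpos: "r \<le> 0 \<Longrightarrow> pos_powr z r = 0"
  by (simp add: pos_powr_def)

lemma pos_powr_eq_powr: "r > 0 \<Longrightarrow> pos_powr z r = of_real r powr z"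
  by (simp add: pos_powr_def powr_def Ln_of_real)

lemma pos_powr_nonzero: "r > 0 \<Longrightarrow> pos_powr z r \<noteq> 0"
  by (simp add: pos_powr_def)

lemma pos_powr_measurable [measurable]: "pos_powr z \<in> borel_measurable borel"
  unfolding pos_powr_def[abs_def] by measurable

lemma norm_pos_powr: "norm (pos_powr z r) = (if r > 0 then r powr Re z else 0)"
  by (simp add: pos_powr_def powr_def)

lemma pos_powr_add: "pos_powr (z + w) r = pos_powr z r * pos_powr w r"
  by (simp add: pos_powr_def exp_add algebra_simps)

lemma pos_powr_mult: "r > 0 \<Longrightarrow> s > 0 \<Longrightarrow> pos_powr z (r * s) = pos_powr z r * pos_powr z s"
  by (simp add: pos_powr_def ln_mult exp_add[symmetric] algebra_simps)

lemma pos_powr_zero: "r > 0 \<Longrightarrow> pos_powr 0 r = 1"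
  by (simp add: pos_powr_def)

lemma pos_powr_of_nat_mult: "r > 0 \<Longrightarrow> pos_powr (z * of_nat n) r = pos_powr z r ^ n"
  by (simp add: pos_powr_def exp_of_nat_mult[symmetric] mult_ac)

section \<open>Convolution of integrable functions and the Beta integral\<close>

lemma integrable_cmult_iff:
  fixes f :: "'a \<Rightarrow> complex"
  assumes "c \<noteq> 0"
  shows "integrable M (\<lambda>x. c * f x) \<longleftrightarrow> integrable M f"
proof
  assume "integrable M (\<lambda>x. c * f x)"
  then have "integrable M (\<lambda>x. inverse c * (c * f x))" by (rule integrable_mult_right)
  then show "integrable M f" using assms by (simp add: mult.assoc[symmetric])
qed (rule integrable_mult_right)

text \<open>With the integral over \<open>r\<close> taken first, translation invariance leaves a
  constant times \<open>h y\<close>, and likewise for the norms. It is meant for two Gamma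
  integrands, whose convolution is the source of the Beta integral.\<close>

lemma integrable_convolution:
  fixes f h :: "real \<Rightarrow> complex"
  assumes f: "integrable lborel f" and h: "integrable lborel h"
  shows "integrable (lborel \<Otimes>\<^sub>M lborel) (\<lambda>(y, r). f (r - y) * h y)"
    and "(\<integral>y. \<integral>r. f (r - y) * h y \<partial>lborel \<partial>lborel) = (\<integral>r. f r \<partial>lborel) * (\<integral>y. h y \<partial>lborel)"
proof -
  note [measurable] = borel_measurable_integrable[OF f] borel_measurable_integrable[OF h]
  have shift: "integrable lborel (\<lambda>r. f (r - y))" "(\<integral>r. f (r - y) \<partial>lborel) = (\<integral>r. f r \<partial>lborel)" for y
    using lborel_integrable_real_affine[OF f, of 1 "-y"] lborel_integral_real_affine[of 1 f "-y"]
    by simp_all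
  have shiftn: "(\<integral>r. norm (f (r - y)) \<partial>lborel) = (\<integral>r. norm (f r) \<partial>lborel)" for y
    using lborel_integral_real_affine[of 1 "\<lambda>x. norm (f x)" "-y"] by simp
  show "integrable (lborel \<Otimes>\<^sub>M lborel) (\<lambda>(y, r). f (r - y) * h y)"
    by (rule lborel_pair.Fubini_integrable) (auto simp: norm_mult shift shiftn h)
  show "(\<integral>y. \<integral>r. f (r - y) * h y \<partial>lborel \<partial>lborel) = (\<integral>r. f r \<partial>lborel) * (\<integral>y. h y \<partial>lborel)"
    by (simp add: shift)
qed

lemma Re_pos_not_nonpos_Int:
  assumes "Re z > 0"
  shows "z \<notin> \<int>\<^sub>\<le>\<^sub>0"
  using assms by (auto elim!: nonpos_Ints_cases)

lemma Gamma_nonzero_Re_pos: "Re z > 0 \<Longrightarrow> Gamma z \<noteq> 0"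
  using Re_pos_not_nonpos_Int by (simp add: Gamma_eq_zero_iff)

lemma Beta_one_right:
  assumes "Re z > 0"
  shows "Beta z 1 = 1 / z"
proof -
  have "z \<noteq> 0" using assms by auto
  then show ?thesis
    using Gamma_plus1[OF Re_pos_not_nonpos_Int[OF assms]] Gamma_nonzero_Re_pos[OF assms] by (simp add: Beta_def)
qed

lemma Gamma_integral_lborel:
  assumes p: "Re p > 0"
  shows "integrable lborel (\<lambda>t. pos_powr (p - 1) t * of_real (exp (- t)))"
    and "(\<integral>t. pos_powr (p - 1) t * of_real (exp (- t)) \<partial>lborel) = Gamma p"
proof -
  let ?f = "\<lambda>t. complex_of_real t powr (p - 1) / of_real (exp t)"
  have eq: "(\<lambda>t. pos_powr (p - 1) t * of_real (exp (- t))) = (\<lambda>t. indicator {0<..} t *\<^sub>R ?f t)"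
    by (auto simp: fun_eq_iff pos_powr_nonpos pos_powr_eq_powr exp_minus divide_inverse split: split_indicator)
  have *: "integrable lebesgue (\<lambda>t. pos_powr (p - 1) t * of_real (exp (- t)))"
    using absolutely_integrable_Gamma_integral'[OF p] unfolding set_integrable_def eq .
  then show int: "integrable lborel (\<lambda>t. pos_powr (p - 1) t * of_real (exp (- t)))"
    by (subst (asm) integrable_completion) measurable
  have "((\<lambda>t. indicator {0<..} t *\<^sub>R ?f t) has_integral Gamma p) UNIV"
    using Gamma_integral_complex'[OF p]
    by (subst (asm) has_integral_restrict_UNIV[symmetric])
       (auto elim!: has_integral_eq[rotated] simp: indicator_def)
  with has_integral_integral_lborel[OF int]
  show "(\<integral>t. pos_powr (p - 1) t * of_real (exp (- t)) \<partial>lborel) = Gamma p"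
    unfolding eq by (rule has_integral_unique)
qed

text \<open>The substitution \<open>y = r * s\<close> pulls out \<open>r\<close> to the powers
  \<open>p - 1\<close> and \<open>q - 1\<close>, and the Jacobian supplies one more factor
  \<open>r\<close>. Integrability is an equivalence so that it can be carried from one positive
  \<open>r\<close> to all others.\<close>

lemma convolution_pos_powr_scale:
  assumes "r > 0"
  shows "integrable lborel (\<lambda>y. pos_powr (p - 1) (r - y) * pos_powr (q - 1) y) \<longleftrightarrow>
         integrable lborel (\<lambda>y. pos_powr (p - 1) (1 - y) * pos_powr (q - 1) y)"
    and "(\<integral>y. pos_powr (p - 1) (r - y) * pos_powr (q - 1) y \<partial>lborel) =
         pos_powr (p + q - 1) r * (\<integral>y. pos_powr (p - 1) (1 - y) * pos_powr (q - 1) y \<partial>lborel)"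
proof -
  let ?F = "\<lambda>r y. pos_powr (p - 1) (r - y) * pos_powr (q - 1) y"
  have *: "?F r (r * y) = (pos_powr (p - 1) r * pos_powr (q - 1) r) * ?F 1 y" for y
  proof (cases "0 < y \<and> y < 1")
    case True
    then show ?thesis
      using assms pos_powr_mult[of r "1 - y"] pos_powr_mult[of r y] by (simp add: algebra_simps)
  next
    case False
    then consider "y \<le> 0" | "1 \<le> y" by linarith
    then show ?thesis
    proof cases
      case 1
      then show ?thesis using assms by (simp add: pos_powr_nonpos mult_le_0_iff)
    next
      case 2
      then have "r - r * y \<le> 0" using assms by simp
      then show ?thesis using 2 by (simp add: pos_powr_nonpos)
    qed
  qed
  have nz: "pos_powr (p - 1) r * pos_powr (q - 1) r \<noteq> 0" using assms pos_powr_nonzero by simp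
  have r1: "of_real r = pos_powr 1 r" using assms by (simp add: pos_powr_eq_powr)
  have pq: "pos_powr (p + q - 1) r = of_real r * (pos_powr (p - 1) r * pos_powr (q - 1) r)"
    unfolding r1 pos_powr_add[symmetric] by (simp add: algebra_simps)
  show "integrable lborel (?F r) \<longleftrightarrow> integrable lborel (?F 1)"
    using lborel_integrable_real_affine_iff[of r "?F r" 0] assms nz
    by (simp add: * integrable_cmult_iff[OF nz] del: integrable_mult_right_iff)
  show "(\<integral>y. ?F r y \<partial>lborel) = pos_powr (p + q - 1) r * (\<integral>y. ?F 1 y \<partial>lborel)"
    using lborel_integral_real_affine[of r "?F r" 0] assms
    by (simp only: * add_0 integral_mult_right_zero pq) (simp add: scaleR_conv_of_real)
qed

text \<open>Since \<open>exp (- (r - y)) * exp (- y) = exp (- r)\<close>, convolving the Gamma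
  integrands for \<open>p\<close> and \<open>q\<close> gives \<open>exp (- r)\<close> times the
  integral in question. By homogeneity the latter is its value \<open>?C\<close> at 1 times the
  power \<open>p + q - 1\<close> of \<open>r\<close>; integrating over \<open>r\<close> yields
  \<open>Gamma p * Gamma q = Gamma (p + q) * ?C\<close>.\<close>

lemma convolution_pos_powr:
  assumes p: "Re p > 0" and q: "Re q > 0"
  shows "integrable lborel (\<lambda>y. pos_powr (p - 1) (r - y) * pos_powr (q - 1) y)"
    and "(\<integral>y. pos_powr (p - 1) (r - y) * pos_powr (q - 1) y \<partial>lborel) = Beta p q * pos_powr (p + q - 1) r"
proof -
  let ?F = "\<lambda>r y. pos_powr (p - 1) (r - y) * pos_powr (q - 1) y"
  let ?f = "\<lambda>p t. pos_powr (p - 1) t * complex_of_real (exp (- t))"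
  have pq: "Re (p + q) > 0" using p q by simp
  have zero: "?F r y = 0" if "r \<le> 0" for r y
    using that by (cases "y > 0") (simp_all add: pos_powr_nonpos)
  have prod: "?f p (r - y) * ?f q y = of_real (exp (- r)) * ?F r y" for r y
    by (simp add: exp_diff exp_minus field_simps)
  note I = integrable_convolution[OF Gamma_integral_lborel(1)[OF p] Gamma_integral_lborel(1)[OF q],
      unfolded prod Gamma_integral_lborel(2)[OF p] Gamma_integral_lborel(2)[OF q]]
  have "AE r in lborel. integrable lborel (\<lambda>y. of_real (exp (- r)) * ?F r y)"
    using lborel_pair.AE_integrable_snd[OF I(1)] .
  then have ae: "AE r in lborel. integrable lborel (?F r)" by (simp add: integrable_cmult_iff)
  \<comment> \<open>Fubini gives integrability for almost every \<open>r\<close> only. A single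
    positive one suffices, as scaling carries it to 1 and from there to every positive
    \<open>r\<close>.\<close>
  have "\<exists>r>0. integrable lborel (?F r)"
  proof (rule ccontr)
    assume "\<not> (\<exists>r>0. integrable lborel (?F r))"
    with ae have "AE r in lborel. r \<notin> {0<..<1::real}" by (auto elim!: eventually_mono)
    then have "{0<..<1::real} \<in> null_sets lborel" by (subst AE_iff_null_sets) auto
    then have "emeasure lborel {0<..<1::real} = 0" by blast
    then show False by simp
  qed
  then have int1: "integrable lborel (?F 1)" using convolution_pos_powr_scale(1) by blast
  show "integrable lborel (?F r)" for r
  proof (cases "r > 0")
    case False
    then have "?F r = (\<lambda>_. 0)" using zero by (intro ext) simp
    then show ?thesis by simp
  qed (use int1 convolution_pos_powr_scale(1) in blast)
  let ?C = "\<integral>y. ?F 1 y \<partial>lborel"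
  have C: "(\<integral>y. ?F r y \<partial>lborel) = pos_powr (p + q - 1) r * ?C" for r
  proof (cases "r > 0")
    case False
    then have "?F r = (\<lambda>_. 0)" using zero by (intro ext) simp
    then show ?thesis using False by (simp add: pos_powr_nonpos)
  qed (rule convolution_pos_powr_scale(2))
  have "Gamma p * Gamma q = (\<integral>r. \<integral>y. of_real (exp (- r)) * ?F r y \<partial>lborel \<partial>lborel)"
    unfolding I(2)[symmetric] by (rule lborel_pair.Fubini_integral[symmetric]) (rule I(1))
  also have "\<dots> = (\<integral>r. ?f (p + q) r * ?C \<partial>lborel)"
  proof (rule Bochner_Integration.integral_cong[OF refl])
    show "(\<integral>y. of_real (exp (- r)) * ?F r y \<partial>lborel) = ?f (p + q) r * ?C" for r
      unfolding integral_mult_right_zero by (subst C) (simp only: mult_ac)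
  qed
  also have "\<dots> = Gamma (p + q) * ?C"
    using Gamma_integral_lborel(2)[OF pq] by simp
  finally have "?C = Beta p q"
    using Gamma_nonzero_Re_pos[OF pq] by (simp add: Beta_def)
  with C show "(\<integral>y. ?F r y \<partial>lborel) = Beta p q * pos_powr (p + q - 1) r" for r by simp
qed

section \<open>Fractional power series kernels and their convolution\<close>

text \<open>\<open>M\<close> stands for the total increment \<open>g b - g a\<close>, the largest
  difference of values of \<open>g\<close> on the interval.\<close>

locale radius_exponent =
  fixes M :: real and \<beta> :: complex
  assumes M: "M > 0" and \<beta>: "Re \<beta> > 0"
begin

text \<open>At \<open>r = M\<close> the modulus of \<open>r powr \<beta>\<close> is
  \<open>M powr Re \<beta>\<close>, so this is absolute convergence up to and including the largest
  increment. It gives one majorant for all \<open>r \<le> M\<close>.\<close>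

definition admissible :: "(nat \<Rightarrow> complex) \<Rightarrow> bool" where
  "admissible c \<longleftrightarrow> summable (\<lambda>n. norm (c n) * M powr (Re \<beta> * n))"

text \<open>The cut at \<open>M\<close> makes the kernel integrable over the whole line without
  affecting any increment that occurs in the interval.\<close>

definition power_kernel :: "complex \<Rightarrow> (nat \<Rightarrow> complex) \<Rightarrow> real \<Rightarrow> complex" where
  "power_kernel p c r = (if r \<le> M then \<Sum>n. c n * pos_powr (\<beta> * of_nat n + p - 1) r else 0)"

text \<open>The terms \<open>i\<close> and \<open>k - i\<close> of the two series convolve to the
  same power \<open>\<beta> * k + p + q - 1\<close>, with a Beta value as factor; hence a Cauchy
  product weighted by Beta values.\<close>

definition convolution_coef :: "complex \<Rightarrow> (nat \<Rightarrow> complex) \<Rightarrow> complex \<Rightarrow> (nat \<Rightarrow> complex) \<Rightarrow> nat \<Rightarrow> complex" where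
  "convolution_coef p c q d k =
     (\<Sum>i\<le>k. c i * d (k - i) * Beta (\<beta> * of_nat i + p) (\<beta> * of_nat (k - i) + q))"

lemma power_kernel_nonpos: "r \<le> 0 \<Longrightarrow> power_kernel p c r = 0"
  by (simp add: power_kernel_def pos_powr_nonpos)

lemma power_kernel_large: "r > M \<Longrightarrow> power_kernel p c r = 0"
  by (simp add: power_kernel_def)

lemma power_kernel_measurable [measurable]: "power_kernel p c \<in> borel_measurable borel"
  unfolding power_kernel_def[abs_def] by measurable

lemma norm_pos_powr_le:
  assumes "r \<le> M"
  shows "norm (pos_powr (\<beta> * of_nat n + p) r) \<le> M powr (Re \<beta> * n) * norm (pos_powr p r)"
proof (cases "r > 0")
  case True
  then have "r powr (Re \<beta> * n) \<le> M powr (Re \<beta> * n)"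
    using assms \<beta> by (intro powr_mono2) auto
  then show ?thesis using True
    by (simp add: norm_pos_powr powr_add mult_right_mono)
qed (simp add: pos_powr_nonpos)

lemma summable_power_kernel:
  assumes "admissible c" "r \<le> M"
  shows "summable (\<lambda>n. norm (c n * pos_powr (\<beta> * of_nat n + p) r))"
    and "(\<Sum>n. norm (c n * pos_powr (\<beta> * of_nat n + p) r)) \<le>
           (\<Sum>n. norm (c n) * M powr (Re \<beta> * n)) * norm (pos_powr p r)"
proof -
  have s: "summable (\<lambda>n. norm (c n) * M powr (Re \<beta> * n) * norm (pos_powr p r))"
    using assms(1) unfolding admissible_def by (rule summable_mult2)
  have le: "norm (c n * pos_powr (\<beta> * of_nat n + p) r) \<le> norm (c n) * M powr (Re \<beta> * n) * norm (pos_powr p r)" for n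
    using mult_left_mono[OF norm_pos_powr_le[OF assms(2)], of "norm (c n)" n p]
    by (simp add: norm_mult mult.assoc)
  show s': "summable (\<lambda>n. norm (c n * pos_powr (\<beta> * of_nat n + p) r))"
    by (rule summable_comparison_test'[OF s]) (use le in auto)
  have "(\<Sum>n. norm (c n * pos_powr (\<beta> * of_nat n + p) r)) \<le> (\<Sum>n. norm (c n) * M powr (Re \<beta> * n) * norm (pos_powr p r))"
    by (rule suminf_le[OF le s' s])
  also have "\<dots> = (\<Sum>n. norm (c n) * M powr (Re \<beta> * n)) * norm (pos_powr p r)"
    using assms(1) unfolding admissible_def by (rule suminf_mult2[symmetric])
  finally show "(\<Sum>n. norm (c n * pos_powr (\<beta> * of_nat n + p) r)) \<le>
           (\<Sum>n. norm (c n) * M powr (Re \<beta> * n)) * norm (pos_powr p r)" .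
qed

text \<open>Up to \<open>M\<close> the series is bounded by a constant times its leading power. The
  factor \<open>exp M\<close> makes up for \<open>exp (- r)\<close>, so that the Gamma integrand can
  serve as majorant on the whole line.\<close>

lemma power_kernel_integrable:
  assumes "admissible c" "Re p > 0"
  shows "integrable lborel (power_kernel p c)"
proof -
  let ?C = "\<Sum>n. norm (c n) * M powr (Re \<beta> * n)"
  let ?g = "\<lambda>t. pos_powr (p - 1) t * complex_of_real (exp (- t))"
  have C0: "?C \<ge> 0"
    using assms(1) unfolding admissible_def by (intro suminf_nonneg) auto
  have *: "norm (power_kernel p c r) \<le> ?C * exp M * norm (?g r)" for r
  proof (cases "0 < r \<and> r \<le> M")
    case True
    then have "norm (power_kernel p c r) = norm (\<Sum>n. c n * pos_powr (\<beta> * of_nat n + (p - 1)) r)"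
      by (simp add: power_kernel_def add_diff_eq)
    also have "\<dots> \<le> (\<Sum>n. norm (c n * pos_powr (\<beta> * of_nat n + (p - 1)) r))"
      using True assms by (intro summable_norm summable_power_kernel) auto
    also have "\<dots> \<le> ?C * norm (pos_powr (p - 1) r)"
      using True assms by (intro summable_power_kernel) auto
    also have "\<dots> \<le> ?C * (exp M * norm (?g r))"
    proof (rule mult_left_mono[OF _ C0])
      have "1 \<le> exp (M - r)" using True by simp
      then have "1 * norm (pos_powr (p - 1) r) \<le> exp (M - r) * norm (pos_powr (p - 1) r)"
        by (rule mult_right_mono) simp
      then show "norm (pos_powr (p - 1) r) \<le> exp M * norm (?g r)"
        by (simp add: norm_mult norm_divide exp_diff exp_minus field_simps)
    qed
    finally show ?thesis by (simp add: mult.assoc)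
  next
    case False
    then have "power_kernel p c r = 0" by (auto simp: power_kernel_nonpos power_kernel_large not_less not_le)
    then show ?thesis using C0 by simp
  qed
  have "integrable lborel (\<lambda>r. ?C * exp M * norm (?g r))"
    using Gamma_integral_lborel(1)[OF assms(2)] by simp
  then show ?thesis
    by (rule Bochner_Integration.integrable_bound) (use * C0 in \<open>auto intro: order_trans\<close>)
qed

text \<open>The product of the two kernels is expanded as a Cauchy product and integrated term by
  term. Each term is bounded by a summable constant times the convolution of the two leading powers,
  which justifies the exchange.\<close>

lemma power_kernel_convolution:
  assumes c: "admissible c" and d: "admissible d" and p: "Re p > 0" and q: "Re q > 0"
  shows "admissible (convolution_coef p c q d)"
    and "r \<le> M \<Longrightarrow> (\<integral>y. power_kernel p c (r - y) * power_kernel q d y \<partial>lborel) = power_kernel (p + q) (convolution_coef p c q d) r"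
proof -
  \<comment> \<open>\<open>T r k\<close> is the \<open>k\<close>-th term of the Cauchy product. For
    \<open>r \<le> M\<close> its norm is at most \<open>A k\<close> times that of the product of the
    leading powers, and \<open>B r\<close> is the integral of the latter.\<close>
  define B where "B r = (\<integral>y. norm (pos_powr (p - 1) (r - y) * pos_powr (q - 1) y) \<partial>lborel)" for r
  define A where "A k = (\<Sum>i\<le>k. (norm (c i) * M powr (Re \<beta> * i)) * (norm (d (k - i)) * M powr (Re \<beta> * (k - i))))" for k
  define T where "T r k y = (\<Sum>i\<le>k. c i * pos_powr (\<beta> * of_nat i + (p - 1)) (r - y) *
                    (d (k - i) * pos_powr (\<beta> * of_nat (k - i) + (q - 1)) y))" for r :: real and k :: nat and y :: real
  have A_nonneg: "A k \<ge> 0" for k unfolding A_def by (intro sum_nonneg) auto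
  have A_sum: "summable A"
    unfolding A_def using c d unfolding admissible_def
    by (intro summable_Cauchy_product) simp_all
  have A_eq: "A k = (\<Sum>i\<le>k. norm (c i) * norm (d (k - i))) * M powr (Re \<beta> * k)" for k
    unfolding A_def sum_distrib_right
    by (intro sum.cong) (simp_all add: powr_add[symmetric] of_nat_diff algebra_simps)
  have T_bound: "norm (T r k y) \<le> A k * norm (pos_powr (p - 1) (r - y) * pos_powr (q - 1) y)" if "r \<le> M" for r k y
  proof (cases "0 < y \<and> y < r")
    case True
    have "norm (c i * pos_powr (\<beta> * of_nat i + (p - 1)) (r - y) * (d (k - i) * pos_powr (\<beta> * of_nat (k - i) + (q - 1)) y))
        \<le> (norm (c i) * M powr (Re \<beta> * i)) * (norm (d (k - i)) * M powr (Re \<beta> * (k - i))) *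
            norm (pos_powr (p - 1) (r - y) * pos_powr (q - 1) y)" if i: "i \<le> k" for i
    proof -
      have "norm (c i) * norm (pos_powr (\<beta> * of_nat i + (p - 1)) (r - y)) * (norm (d (k - i)) * norm (pos_powr (\<beta> * of_nat (k - i) + (q - 1)) y))
        \<le> norm (c i) * (M powr (Re \<beta> * i) * norm (pos_powr (p - 1) (r - y))) * 
          (norm (d (k - i)) * (M powr (Re \<beta> * (k - i)) * norm (pos_powr (q - 1) y)))"
        using True \<open>r \<le> M\<close> i norm_pos_powr_le[of "r - y" i "p - 1"] norm_pos_powr_le[of y "k - i" "q - 1"]
        by (intro mult_mono mult_left_mono mult_nonneg_nonneg) (auto simp: of_nat_diff)
      then show ?thesis by (simp add: norm_mult mult_ac)
    qed
    then show ?thesis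
      unfolding T_def A_def sum_distrib_right by (intro order_trans[OF norm_sum] sum_mono) simp
  next
    case False
    then have "pos_powr z (r - y) * pos_powr w y = 0" for z w
      by (auto simp: not_less pos_powr_nonpos)
    then have "T r k y = 0" unfolding T_def by (intro sum.neutral) (auto simp: mult_ac)
    then show ?thesis using A_nonneg by simp
  qed
  have term_int: "integrable lborel (\<lambda>y. pos_powr (\<beta> * of_nat i + (p - 1)) (r - y) * pos_powr (\<beta> * of_nat j + (q - 1)) y)"
      "(\<integral>y. pos_powr (\<beta> * of_nat i + (p - 1)) (r - y) * pos_powr (\<beta> * of_nat j + (q - 1)) y \<partial>lborel)
        = Beta (\<beta> * of_nat i + p) (\<beta> * of_nat j + q) * pos_powr (\<beta> * of_nat (i + j) + (p + q) - 1) r" for i j r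
  proof -
    have "Re (\<beta> * of_nat i + p) > 0" "Re (\<beta> * of_nat j + q) > 0"
      using p q \<beta> by (auto intro!: add_nonneg_pos)
    from convolution_pos_powr[OF this, of r]
    show "integrable lborel (\<lambda>y. pos_powr (\<beta> * of_nat i + (p - 1)) (r - y) * pos_powr (\<beta> * of_nat j + (q - 1)) y)"
      "(\<integral>y. pos_powr (\<beta> * of_nat i + (p - 1)) (r - y) * pos_powr (\<beta> * of_nat j + (q - 1)) y \<partial>lborel)
        = Beta (\<beta> * of_nat i + p) (\<beta> * of_nat j + q) * pos_powr (\<beta> * of_nat (i + j) + (p + q) - 1) r"
      by (simp_all add: algebra_simps)
  qed
  have T_alt: "T r k y = (\<Sum>i\<le>k. (c i * d (k - i)) * (pos_powr (\<beta> * of_nat i + (p - 1)) (r - y) *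
                     pos_powr (\<beta> * of_nat (k - i) + (q - 1)) y))" for r k y
    unfolding T_def by (simp add: mult_ac)
  have T_int: "integrable lborel (T r k)" for r k
    unfolding T_alt by (intro Bochner_Integration.integrable_sum integrable_mult_right term_int)
  have T_val: "(\<integral>y. T r k y \<partial>lborel) = convolution_coef p c q d k * pos_powr (\<beta> * of_nat k + (p + q) - 1) r" for r k
  proof -
    have "(\<integral>y. T r k y \<partial>lborel) = (\<Sum>i\<le>k. (c i * d (k - i)) * 
        (Beta (\<beta> * of_nat i + p) (\<beta> * of_nat (k - i) + q) * pos_powr (\<beta> * of_nat (i + (k - i)) + (p + q) - 1) r))"
      unfolding T_alt
      by (subst Bochner_Integration.integral_sum)
         (intro integrable_mult_right term_int, simp only: integral_mult_right_zero term_int)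
    then show ?thesis
      by (simp add: convolution_coef_def sum_distrib_right mult.assoc)
  qed
  have B_int: "integrable lborel (\<lambda>y. norm (pos_powr (p - 1) (r - y) * pos_powr (q - 1) y))" for r
    using convolution_pos_powr(1)[OF p q, of r] by (rule integrable_norm)
  have T_norm: "(\<integral>y. norm (T r k y) \<partial>lborel) \<le> A k * B r" if "r \<le> M" for r k
    unfolding B_def integral_mult_right_zero[symmetric]
    by (intro integral_mono integrable_norm T_int integrable_mult_right B_int T_bound that)
  \<comment> \<open>The Beta values are estimated through the integral they come from: at
    \<open>r = M\<close> the integral of \<open>T\<close> is the new coefficient times a power of
    \<open>M\<close>, and its norm is at most \<open>A k * B M\<close>.\<close>
  show "admissible (convolution_coef p c q d)"
    unfolding admissible_def
  proof (rule summable_comparison_test'[of "\<lambda>k. A k * (B M / M powr Re (p + q - 1))" 0])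
    show "summable (\<lambda>k. A k * (B M / M powr Re (p + q - 1)))"
      using A_sum by (rule summable_mult2)
    fix k :: nat
    have "norm (convolution_coef p c q d k) * (M powr (Re \<beta> * k) * M powr Re (p + q - 1)) = norm (\<integral>y. T M k y \<partial>lborel)"
      unfolding T_val using M by (simp add: norm_mult norm_pos_powr powr_add[symmetric] algebra_simps)
    also have "\<dots> \<le> A k * B M"
      by (rule order_trans[OF integral_norm_bound T_norm]) simp
    finally show "norm (norm (convolution_coef p c q d k) * M powr (Re \<beta> * k)) \<le> A k * (B M / M powr Re (p + q - 1))"
      using M by (simp add: field_simps)
  qed
  assume r: "r \<le> M"
  have sn: "summable (\<lambda>k. norm (T r k y))" for y
    by (rule summable_comparison_test'[of "\<lambda>k. A k * norm (pos_powr (p - 1) (r - y) * pos_powr (q - 1) y)" 0])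
       (use T_bound[OF r] A_sum in \<open>auto intro: summable_mult2\<close>)
  have eq: "power_kernel p c (r - y) * power_kernel q d y = (\<Sum>k. T r k y)" for y
  proof (cases "0 < y \<and> y < r")
    case True
    then show ?thesis unfolding T_def
      using r c d 
      by (subst Cauchy_product[symmetric])
         (auto simp: power_kernel_def add_diff_eq intro!: summable_power_kernel[of _ _ "_ - 1", unfolded add_diff_eq])
  next
    case False
    then have "pos_powr z (r - y) * pos_powr w y = 0" for z w
      by (auto simp: not_less pos_powr_nonpos)
    then have "T r k y = 0" for k unfolding T_def by (intro sum.neutral) (auto simp: mult_ac)
    then show ?thesis using False by (auto simp: not_less power_kernel_nonpos)
  qed
  have "(\<integral>y. power_kernel p c (r - y) * power_kernel q d y \<partial>lborel) = (\<Sum>k. \<integral>y. T r k y \<partial>lborel)"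
    unfolding eq
  proof (rule integral_suminf[OF T_int])
    show "AE y in lborel. summable (\<lambda>k. norm (T r k y))" using sn by simp
    show "summable (\<lambda>k. \<integral>y. norm (T r k y) \<partial>lborel)"
      by (rule summable_comparison_test'[of "\<lambda>k. A k * B r" 0])
         (use T_norm[OF r] A_sum in \<open>auto intro: summable_mult2\<close>)
  qed
  then show "(\<integral>y. power_kernel p c (r - y) * power_kernel q d y \<partial>lborel) = power_kernel (p + q) (convolution_coef p c q d) r"
    using r by (simp add: T_val power_kernel_def)
qed

section \<open>Uniqueness of the coefficients of a kernel\<close>

lemma power_kernel_power_series:
  assumes "0 < r" "r \<le> M" "admissible c"
  shows "(\<lambda>n. c n * pos_powr \<beta> r ^ n) sums (power_kernel p c r / pos_powr (p - 1) r)"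
proof -
  have eq: "c n * pos_powr (\<beta> * of_nat n + (p - 1)) r = (c n * pos_powr \<beta> r ^ n) * pos_powr (p - 1) r" for n
    using assms(1) pos_powr_of_nat_mult[of r \<beta> n] pos_powr_add[of "\<beta> * of_nat n" "p - 1" r] by simp
  have "(\<lambda>n. c n * pos_powr (\<beta> * of_nat n + (p - 1)) r) sums power_kernel p c r"
    using summable_sums[OF summable_norm_cancel[OF summable_power_kernel(1)[OF assms(3,2), of "p - 1"]]] assms(2)
    by (simp add: power_kernel_def add_diff_eq)
  then have "(\<lambda>n. (c n * pos_powr \<beta> r ^ n) * pos_powr (p - 1) r / pos_powr (p - 1) r) sums (power_kernel p c r / pos_powr (p - 1) r)"
    unfolding eq by (rule sums_divide)
  then show ?thesis using pos_powr_nonzero[OF assms(1)] by simp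
qed

text \<open>Divided by the leading power, the kernels are power series in
  \<open>r powr \<beta>\<close>. If the coefficients below \<open>k\<close> agree, the difference
  series divided by \<open>z ^ k\<close> tends to \<open>f k\<close> at 0, yet it vanishes along
  points \<open>r powr \<beta>\<close> that tend to 0 because \<open>Re \<beta> > 0\<close>.\<close>

lemma power_kernel_unique:
  assumes c: "admissible c" and d: "admissible d"
    and ev: "\<And>e. e > 0 \<Longrightarrow> \<exists>r. 0 < r \<and> r < e \<and> power_kernel p c r = power_kernel p d r"
  shows "c = d"
proof -
  define f where "f n = c n - d n" for n
  define s where "s = M powr Re \<beta>"
  have s: "s > 0" unfolding s_def using M by simp
  have f_sum: "summable (\<lambda>n. f n * z ^ n)" if "norm z < s" for z
  proof -
    have sM: "s ^ n = M powr (Re \<beta> * n)" for n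
      unfolding s_def using M by (simp add: powr_powr[symmetric] powr_realpow)
    have "summable (\<lambda>n. norm (c n) * s ^ n + norm (d n) * s ^ n)"
      using c d unfolding admissible_def sM by (rule summable_add)
    then have "summable (\<lambda>n. f n * of_real s ^ n)"
      by (rule summable_comparison_test')
         (use s in \<open>auto simp: f_def norm_mult norm_power distrib_right[symmetric] intro!: mult_right_mono norm_triangle_ineq4\<close>)
    then show ?thesis by (rule powser_inside) (use that s in simp)
  qed
  have "f k = 0" for k
  proof (induction k rule: less_induct)
    case (less k)
    define G where "G z = (\<Sum>n. f (n + k) * z ^ n)" for z
    have zero_initial: "(\<Sum>i<k. f i * z ^ i) = 0" for z
      using less by (intro sum.neutral) auto
    have G_sums: "(\<lambda>n. f (n + k) * z ^ n) sums G z" if "norm z < s" for z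
    proof (cases "z = 0")
      case False
      have "summable (\<lambda>n. f (n + k) * z ^ (n + k))"
        using f_sum[OF that] by (rule summable_ignore_initial_segment)
      then have "summable (\<lambda>n. f (n + k) * z ^ (n + k) / z ^ k)" by (rule summable_divide)
      then show ?thesis using False unfolding G_def by (simp add: power_add summable_sums)
    qed (simp add: G_def powser_sums_zero_iff)
    have lim: "(G \<longlongrightarrow> f k) (at 0)"
      using powser_limit_0[OF s, of "\<lambda>n. f (n + k)" G] G_sums by simp
    \<comment> \<open>The bound \<open>e n\<close> sends \<open>r n\<close> to 0 and keeps it below
      \<open>M\<close>, where the kernels are given by their series.\<close>
    define e where "e n = min M (1 / real (Suc n))" for n
    have e: "e n > 0" for n using M by (simp add: e_def)
    have "\<exists>r. \<forall>n. 0 < r n \<and> r n < e n \<and> power_kernel p c (r n) = power_kernel p d (r n)"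
      using ev[OF e] by (intro choice) auto
    then obtain r where r: "0 < r n" "r n < e n" "power_kernel p c (r n) = power_kernel p d (r n)" for n by blast
    have "e \<longlonglongrightarrow> min M 0"
      unfolding e_def by (intro tendsto_min tendsto_const LIMSEQ_Suc[OF lim_1_over_n])
    then have r_lim: "r \<longlonglongrightarrow> 0"
      using M r by (intro tendsto_sandwich[of "\<lambda>_. 0" r sequentially e]) (auto simp: less_imp_le)
    define z where "z n = pos_powr \<beta> (r n)" for n
    have "(\<lambda>n. r n powr Re \<beta>) \<longlonglongrightarrow> 0"
      using tendsto_zero_powrI[OF r_lim tendsto_const _ \<beta>] r by (simp add: less_imp_le)
    then have "(\<lambda>n. norm (z n)) \<longlonglongrightarrow> 0" using r by (simp add: z_def norm_pos_powr)
    then have z_lim: "z \<longlonglongrightarrow> 0" by (rule tendsto_norm_zero_cancel)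
    have z0: "z n \<noteq> 0" for n using r pos_powr_nonzero by (simp add: z_def)
    have "filterlim z (at 0) sequentially"
      using z_lim z0 by (auto simp: filterlim_at)
    then have "(\<lambda>n. G (z n)) \<longlonglongrightarrow> f k"
      using lim by (rule filterlim_compose[rotated])
    moreover have "G (z n) = 0" for n
    proof -
      have rM: "r n < M" using r(2)[of n] by (simp add: e_def)
      have zs: "norm (z n) < s"
        using r(1)[of n] rM \<beta> by (simp add: z_def norm_pos_powr s_def powr_less_mono2)
      have "(\<lambda>i. c i * z n ^ i - d i * z n ^ i) sums
          (power_kernel p c (r n) / pos_powr (p - 1) (r n) - power_kernel p d (r n) / pos_powr (p - 1) (r n))"
        unfolding z_def using r(1)[of n] rM c d by (intro sums_diff power_kernel_power_series) auto
      then have "(\<lambda>i. f i * z n ^ i) sums 0"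
        using r(3)[of n] by (simp add: f_def left_diff_distrib)
      then have "(\<lambda>i. f (i + k) * z n ^ (i + k)) sums 0"
        using zero_initial[of "z n"] sums_iff_shift[of "\<lambda>i. f i * z n ^ i" k 0] by simp
      then have "(\<lambda>i. f (i + k) * z n ^ (i + k) / z n ^ k) sums (0 / z n ^ k)"
        by (rule sums_divide)
      then have "(\<lambda>i. f (i + k) * z n ^ i) sums 0"
        using z0[of n] by (simp add: power_add)
      then show ?thesis using G_sums[OF zs] by (simp add: sums_unique2)
    qed
    ultimately show "f k = 0" by (simp add: LIMSEQ_const_iff)
  qed
  then show ?thesis by (auto simp: f_def fun_eq_iff)
qed

end

section \<open>Integral operators along a nondecreasing function\<close>

text \<open>By Tonelli the triple integral of the norms is at most \<open>C * C\<close> times the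
  norm of \<open>u\<close>: integrate \<open>\<kappa>\<close> over \<open>x\<close>, then
  \<open>\<eta>\<close> over \<open>t\<close>. Hence for almost every \<open>x\<close> the remaining
  double integral is finite and Fubini applies.\<close>

lemma composition_Fubini:
  fixes \<kappa> \<eta> :: "real \<Rightarrow> real \<Rightarrow> complex" and u :: "real \<Rightarrow> complex" and C :: real
  assumes "sigma_finite_measure \<mu>" and sets [measurable_cong]: "sets \<mu> = sets borel"
    and [measurable]: "case_prod \<kappa> \<in> borel_measurable (borel \<Otimes>\<^sub>M borel)"
      "case_prod \<eta> \<in> borel_measurable (borel \<Otimes>\<^sub>M borel)"
    and u: "integrable \<mu> u"
    and \<kappa>: "\<And>t. (\<integral>\<^sup>+x. norm (\<kappa> x t) \<partial>\<mu>) \<le> ennreal C"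
    and \<eta>: "\<And>s. (\<integral>\<^sup>+t. norm (\<eta> t s) \<partial>\<mu>) \<le> ennreal C"
  shows "AE x in \<mu>. (\<integral>t. \<kappa> x t * (\<integral>s. \<eta> t s * u s \<partial>\<mu>) \<partial>\<mu>) = (\<integral>s. (\<integral>t. \<kappa> x t * \<eta> t s \<partial>\<mu>) * u s \<partial>\<mu>)"
proof -
  interpret sigma_finite_measure \<mu> by fact
  interpret pair_sigma_finite \<mu> \<mu> ..
  have [measurable]: "u \<in> borel_measurable borel"
    using borel_measurable_integrable[OF u] by (simp cong: measurable_cong_sets add: sets)
  let ?N = "\<lambda>x. \<integral>\<^sup>+t. \<integral>\<^sup>+s. norm (\<kappa> x t * \<eta> t s * u s) \<partial>\<mu> \<partial>\<mu>"
  have fact: "ennreal (norm (\<kappa> x t * \<eta> t s * u s)) =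
      ennreal (norm (\<kappa> x t)) * (ennreal (norm (\<eta> t s)) * ennreal (norm (u s)))" for x t s
    by (simp add: norm_mult ennreal_mult mult.assoc)
  let ?U = "\<integral>\<^sup>+s. norm (u s) \<partial>\<mu>"
  have "(\<integral>\<^sup>+x. ?N x \<partial>\<mu>) = (\<integral>\<^sup>+x. \<integral>\<^sup>+t. ennreal (norm (\<kappa> x t)) * (\<integral>\<^sup>+s. ennreal (norm (\<eta> t s)) * ennreal (norm (u s)) \<partial>\<mu>) \<partial>\<mu> \<partial>\<mu>)"
    unfolding fact by (simp add: nn_integral_cmult)
  also have "\<dots> = (\<integral>\<^sup>+t. \<integral>\<^sup>+x. ennreal (norm (\<kappa> x t)) * (\<integral>\<^sup>+s. ennreal (norm (\<eta> t s)) * ennreal (norm (u s)) \<partial>\<mu>) \<partial>\<mu> \<partial>\<mu>)"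
    by (rule Fubini') measurable
  also have "\<dots> = (\<integral>\<^sup>+t. (\<integral>\<^sup>+x. norm (\<kappa> x t) \<partial>\<mu>) * (\<integral>\<^sup>+s. ennreal (norm (\<eta> t s)) * ennreal (norm (u s)) \<partial>\<mu>) \<partial>\<mu>)"
    by (simp add: nn_integral_multc)
  also have "\<dots> \<le> (\<integral>\<^sup>+t. ennreal C * (\<integral>\<^sup>+s. ennreal (norm (\<eta> t s)) * ennreal (norm (u s)) \<partial>\<mu>) \<partial>\<mu>)"
    by (intro nn_integral_mono mult_right_mono \<kappa>) simp
  also have "\<dots> = ennreal C * (\<integral>\<^sup>+t. \<integral>\<^sup>+s. ennreal (norm (\<eta> t s)) * ennreal (norm (u s)) \<partial>\<mu> \<partial>\<mu>)"
    by (simp add: nn_integral_cmult)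
  also have "\<dots> = ennreal C * (\<integral>\<^sup>+s. \<integral>\<^sup>+t. ennreal (norm (\<eta> t s)) * ennreal (norm (u s)) \<partial>\<mu> \<partial>\<mu>)"
    by (subst Fubini') simp_all
  also have "\<dots> = ennreal C * (\<integral>\<^sup>+s. (\<integral>\<^sup>+t. norm (\<eta> t s) \<partial>\<mu>) * ennreal (norm (u s)) \<partial>\<mu>)"
    by (simp add: nn_integral_multc)
  also have "\<dots> \<le> ennreal C * (\<integral>\<^sup>+s. ennreal C * ennreal (norm (u s)) \<partial>\<mu>)"
    by (intro mult_left_mono nn_integral_mono mult_right_mono \<eta>) simp_all
  also have "\<dots> = ennreal C * (ennreal C * ?U)"
    by (simp add: nn_integral_cmult)
  also have "\<dots> < \<infinity>"
    using u by (auto simp: integrable_iff_bounded ennreal_mult_less_top)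
  finally have "AE x in \<mu>. ?N x \<noteq> \<infinity>"
    by (intro nn_integral_PInf_AE) auto
  then show ?thesis
  proof eventually_elim
    case (elim x)
    have [measurable]: "(\<lambda>t. \<kappa> x t) \<in> borel_measurable borel" by measurable
    have int: "integrable (\<mu> \<Otimes>\<^sub>M \<mu>) (\<lambda>(t, s). \<kappa> x t * \<eta> t s * u s)"
      unfolding integrable_iff_bounded
    proof
      have "(\<lambda>(t, s). ennreal (norm (\<kappa> x t * \<eta> t s * u s))) \<in> borel_measurable (\<mu> \<Otimes>\<^sub>M \<mu>)"
        by measurable
      from sigma_finite_measure.nn_integral_fst[OF assms(1) this] have "?N x = (\<integral>\<^sup>+(t, s). ennreal (norm (\<kappa> x t * \<eta> t s * u s)) \<partial>(\<mu> \<Otimes>\<^sub>M \<mu>))"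
        by simp
      with elim show "(\<integral>\<^sup>+p. ennreal (norm (case p of (t, s) \<Rightarrow> \<kappa> x t * \<eta> t s * u s)) \<partial>(\<mu> \<Otimes>\<^sub>M \<mu>)) < \<infinity>"
        by (simp add: less_top split_beta')
    qed measurable
    have "(\<integral>t. \<kappa> x t * (\<integral>s. \<eta> t s * u s \<partial>\<mu>) \<partial>\<mu>) = (\<integral>t. \<integral>s. \<kappa> x t * \<eta> t s * u s \<partial>\<mu> \<partial>\<mu>)"
      by (simp add: mult.assoc)
    also have "\<dots> = (\<integral>s. \<integral>t. \<kappa> x t * \<eta> t s * u s \<partial>\<mu> \<partial>\<mu>)"
      using Fubini_integral[OF int] by simp
    finally show ?case by simp
  qed
qed

section \<open>The weighted measure, its image under g, and convolution operators\<close>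

locale C1_nondecreasing =
  fixes a b :: real and g g' :: "real \<Rightarrow> real"
  assumes ab: "a < b"
    and deriv: "\<And>x. (g has_real_derivative g' x) (at x)"
    and g'_cont: "continuous_on UNIV g'"
    and g'_nonneg: "\<And>x. g' x \<ge> 0"
    and nonconst: "g a < g b"
begin

text \<open>The density vanishes where \<open>g\<close> is stationary, so almost everywhere for
  \<open>\<mu>\<close> matches equality in the weighted space. Building on \<open>lborel\<close>
  keeps measurability plain Borel, which the product measure arguments use.\<close>

definition \<mu> :: "real measure" where
  "\<mu> = density lborel (\<lambda>t. ennreal (indicator {a..b} t * g' t))"

lemma mono: "x \<le> y \<Longrightarrow> g x \<le> g y"
  using deriv g'_nonneg by (meson DERIV_nonneg_imp_nondecreasing)

lemma g_cont: "continuous_on UNIV g"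
  using deriv by (intro continuous_at_imp_continuous_on ballI DERIV_isCont) blast

lemma g_measurable [measurable]: "g \<in> borel_measurable borel" "g' \<in> borel_measurable borel"
  using g_cont g'_cont by (auto intro: borel_measurable_continuous_onI)

lemma sets_\<mu> [measurable_cong, simp]: "sets \<mu> = sets borel"
  by (simp add: \<mu>_def)

lemma space_\<mu> [simp]: "space \<mu> = UNIV"
  by (simp add: \<mu>_def)

lemma sigma_finite_\<mu>: "sigma_finite_measure \<mu>"
  unfolding \<mu>_def
  by (subst sigma_finite_measure.sigma_finite_iff_density_finite[OF sigma_finite_lborel]) auto

lemma AE_\<mu>: "(AE x in \<mu>. P x) \<longleftrightarrow> (AE x in lborel. x \<in> {a..b} \<and> g' x > 0 \<longrightarrow> P x)"
  unfolding \<mu>_def by (subst AE_density) (auto simp: indicator_def)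

lemma integral_\<mu>:
  assumes "f \<in> borel_measurable borel"
  shows "(\<integral>t. f t \<partial>\<mu>) = (\<integral>t. (indicator {a..b} t * g' t) *\<^sub>R (f t :: complex) \<partial>lborel)"
  unfolding \<mu>_def using assms g'_nonneg by (subst integral_density) auto

lemma integrable_\<mu>:
  assumes "f \<in> borel_measurable borel"
  shows "integrable \<mu> (f :: real \<Rightarrow> complex) \<longleftrightarrow> integrable lborel (\<lambda>t. (indicator {a..b} t * g' t) *\<^sub>R f t)"
  unfolding \<mu>_def using assms g'_nonneg by (subst integrable_density) auto

text \<open>This is substitution along a nondecreasing function. Injectivity may fail, but intervals
  where \<open>g\<close> is constant have \<open>\<mu>\<close>-measure zero.\<close>

lemma distr_\<mu>: "distr \<mu> borel g = density lborel (indicator {g a..g b})"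
proof (rule measure_eqI)
  fix A assume "A \<in> sets (distr \<mu> borel g)"
  then have A[measurable]: "A \<in> sets borel" by simp
  have "emeasure (distr \<mu> borel g) A = (\<integral>\<^sup>+x. indicator A (g x) \<partial>\<mu>)"
    by (simp flip: nn_integral_indicator add: nn_integral_distr)
  also have "\<dots> = (\<integral>\<^sup>+x. indicator A (g x) * ennreal (g' x) * indicator {a..b} x \<partial>lborel)"
    unfolding \<mu>_def by (subst nn_integral_density) (auto intro!: nn_integral_cong split: split_indicator)
  also have "\<dots> = (\<integral>\<^sup>+x. indicator A x * indicator {g a..g b} x \<partial>lborel)"
    using g'_nonneg ab deriv g'_cont
    by (intro nn_integral_substitution_aux[symmetric]) (auto intro: continuous_on_subset)
  also have "\<dots> = emeasure (density lborel (indicator {g a..g b})) A"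
    by (subst emeasure_density) (auto simp: mult.commute)
  finally show "emeasure (distr \<mu> borel g) A = emeasure (density lborel (indicator {g a..g b})) A" .
qed simp

lemma nn_integral_\<mu>_g:
  assumes [measurable]: "f \<in> borel_measurable borel"
  shows "(\<integral>\<^sup>+x. f (g x) \<partial>\<mu>) = (\<integral>\<^sup>+y. indicator {g a..g b} y * f y \<partial>lborel)"
proof -
  have "(\<integral>\<^sup>+x. f (g x) \<partial>\<mu>) = (\<integral>\<^sup>+y. f y \<partial>distr \<mu> borel g)"
    by (subst nn_integral_distr) auto
  then show ?thesis unfolding distr_\<mu> by (subst (asm) nn_integral_density) auto
qed

lemma integral_\<mu>_g:
  fixes f :: "real \<Rightarrow> complex"
  assumes [measurable]: "f \<in> borel_measurable borel"
  shows "(\<integral>x. f (g x) \<partial>\<mu>) = (\<integral>y. indicator {g a..g b} y *\<^sub>R f y \<partial>lborel)"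
proof -
  have "(\<integral>x. f (g x) \<partial>\<mu>) = (\<integral>y. f y \<partial>distr \<mu> borel g)"
    by (subst integral_distr) auto
  also have "\<dots> = (\<integral>y. f y \<partial>density lborel (\<lambda>y. ennreal (indicator {g a..g b} y)))"
    unfolding distr_\<mu> by (simp add: ennreal_indicator)
  also have "\<dots> = (\<integral>y. indicator {g a..g b} y *\<^sub>R f y \<partial>lborel)"
    by (subst integral_density) auto
  finally show ?thesis .
qed

definition convol_op :: "(real \<Rightarrow> complex) \<Rightarrow> (real \<Rightarrow> complex) \<Rightarrow> real \<Rightarrow> complex" where
  "convol_op \<kappa> u x = (\<integral>t. \<kappa> (g x - g t) * u t \<partial>\<mu>)"

lemma convol_op_measurable [measurable]:
  assumes [measurable]: "\<kappa> \<in> borel_measurable borel" "u \<in> borel_measurable borel"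
  shows "convol_op \<kappa> u \<in> borel_measurable borel"
proof -
  interpret sigma_finite_measure \<mu> by (rule sigma_finite_\<mu>)
  show ?thesis unfolding convol_op_def[abs_def] by measurable
qed

text \<open>The bound is uniform in the shift \<open>c\<close>, as \<open>composition_Fubini\<close>
  demands of both kernels.\<close>

lemma nn_integral_kernel_le:
  fixes \<kappa> :: "real \<Rightarrow> complex"
  assumes [measurable]: "\<kappa> \<in> borel_measurable borel"
  shows "(\<integral>\<^sup>+x. norm (\<kappa> (g x - c)) \<partial>\<mu>) \<le> (\<integral>\<^sup>+y. norm (\<kappa> y) \<partial>lborel)"
proof -
  have "(\<integral>\<^sup>+x. norm (\<kappa> (g x - c)) \<partial>\<mu>) = (\<integral>\<^sup>+y. indicator {g a..g b} y * ennreal (norm (\<kappa> (y - c))) \<partial>lborel)"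
    by (rule nn_integral_\<mu>_g) measurable
  also have "\<dots> \<le> (\<integral>\<^sup>+y. ennreal (norm (\<kappa> (y - c))) \<partial>lborel)"
    by (intro nn_integral_mono) (auto split: split_indicator)
  also have "\<dots> = (\<integral>\<^sup>+y. norm (\<kappa> y) \<partial>lborel)"
    using nn_integral_real_affine[of "\<lambda>y. ennreal (norm (\<kappa> y))" 1 "-c"] by simp
  finally show ?thesis .
qed

text \<open>After Fubini the inner integral over \<open>t\<close> is pushed forward by
  \<open>g\<close> to one over \<open>{g a..g b}\<close>. Outside this interval
  \<open>g x - y\<close> or \<open>y - g s\<close> is negative, so it extends to the line, and a
  shift by \<open>g s\<close> turns it into the convolution at \<open>g x - g s\<close>.\<close>

lemma convol_op_compose:
  fixes \<kappa> \<eta> u :: "real \<Rightarrow> complex"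
  assumes \<kappa>: "integrable lborel \<kappa>" "\<And>r. r \<le> 0 \<Longrightarrow> \<kappa> r = 0"
    and \<eta>: "integrable lborel \<eta>" "\<And>r. r \<le> 0 \<Longrightarrow> \<eta> r = 0"
    and \<nu>: "\<And>r. r \<le> g b - g a \<Longrightarrow> (\<integral>y. \<kappa> (r - y) * \<eta> y \<partial>lborel) = \<nu> r"
    and \<nu>_meas: "\<nu> \<in> borel_measurable borel"
    and u: "integrable \<mu> u"
  shows "AE x in \<mu>. convol_op \<kappa> (convol_op \<eta> u) x = convol_op \<nu> u x"
proof -
  have [measurable]: "\<kappa> \<in> borel_measurable borel" "\<eta> \<in> borel_measurable borel"
    "\<nu> \<in> borel_measurable borel" "u \<in> borel_measurable borel"
    using \<kappa> \<eta> \<nu>_meas u by (auto dest!: borel_measurable_integrable simp: measurable_cong_sets[OF sets_\<mu>])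
  define C where "C = max (\<integral>y. norm (\<kappa> y) \<partial>lborel) (\<integral>y. norm (\<eta> y) \<partial>lborel)"
  have le_C: "(\<integral>\<^sup>+y. norm (\<kappa> y) \<partial>lborel) \<le> ennreal C" "(\<integral>\<^sup>+y. norm (\<eta> y) \<partial>lborel) \<le> ennreal C"
    using \<kappa>(1) \<eta>(1) by (auto simp: nn_integral_eq_integral C_def intro!: ennreal_leI)
  have "AE x in \<mu>. (\<integral>t. \<kappa> (g x - g t) * (\<integral>s. \<eta> (g t - g s) * u s \<partial>\<mu>) \<partial>\<mu>) =
                    (\<integral>s. (\<integral>t. \<kappa> (g x - g t) * \<eta> (g t - g s) \<partial>\<mu>) * u s \<partial>\<mu>)"
  proof (rule composition_Fubini[OF sigma_finite_\<mu> sets_\<mu> _ _ u])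
    show "(\<integral>\<^sup>+x. ennreal (norm (\<eta> (g x - g s))) \<partial>\<mu>) \<le> ennreal C" for s
      using nn_integral_kernel_le[of \<eta> "g s"] le_C by simp
    show "(\<integral>\<^sup>+x. ennreal (norm (\<kappa> (g x - g t))) \<partial>\<mu>) \<le> ennreal C" for t
      using nn_integral_kernel_le[of \<kappa> "g t"] le_C by simp
  qed measurable
  moreover have "AE x in \<mu>. x \<in> {a..b}" by (simp add: AE_\<mu>)
  ultimately show ?thesis
  proof eventually_elim
    case (elim x)
    have inner: "(\<integral>t. \<kappa> (g x - g t) * \<eta> (g t - g s) \<partial>\<mu>) = \<nu> (g x - g s)" if s: "s \<in> {a..b}" for s
    proof -
      have "(\<integral>t. \<kappa> (g x - g t) * \<eta> (g t - g s) \<partial>\<mu>) =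
          (\<integral>y. indicator {g a..g b} y *\<^sub>R (\<kappa> (g x - y) * \<eta> (y - g s)) \<partial>lborel)"
        by (rule integral_\<mu>_g) measurable
      also have "\<dots> = (\<integral>y. \<kappa> (g x - y) * \<eta> (y - g s) \<partial>lborel)"
      proof (rule Bochner_Integration.integral_cong[OF refl])
        fix y
        have "\<kappa> (g x - y) * \<eta> (y - g s) = 0" if "y \<notin> {g a..g b}"
          using that mono[of a s] mono[of x b] s elim \<kappa>(2)[of "g x - y"] \<eta>(2)[of "y - g s"] by auto
        then show "indicator {g a..g b} y *\<^sub>R (\<kappa> (g x - y) * \<eta> (y - g s)) = \<kappa> (g x - y) * \<eta> (y - g s)"
          by (auto split: split_indicator)
      qed
      also have "\<dots> = (\<integral>y. \<kappa> (g x - g s - y) * \<eta> y \<partial>lborel)"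
        by (subst lborel_integral_real_affine[of 1 _ "g s"]) (simp_all add: algebra_simps)
      also have "\<dots> = \<nu> (g x - g s)"
        using mono[of a s] mono[of x b] s elim by (intro \<nu>) auto
      finally show ?thesis .
    qed
    have "(\<integral>s. (\<integral>t. \<kappa> (g x - g t) * \<eta> (g t - g s) \<partial>\<mu>) * u s \<partial>\<mu>) = (\<integral>s. \<nu> (g x - g s) * u s \<partial>\<mu>)"
    proof (rule integral_cong_AE)
      show "(\<lambda>s. (\<integral>t. \<kappa> (g x - g t) * \<eta> (g t - g s) \<partial>\<mu>) * u s) \<in> borel_measurable \<mu>"
      proof -
        interpret sigma_finite_measure \<mu> by (rule sigma_finite_\<mu>)
        show ?thesis by measurable
      qed
      show "AE s in \<mu>. (\<integral>t. \<kappa> (g x - g t) * \<eta> (g t - g s) \<partial>\<mu>) * u s = \<nu> (g x - g s) * u s"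
        using inner by (simp add: AE_\<mu>)
    qed measurable
    with elim(1) show ?case unfolding convol_op_def by simp
  qed
qed

text \<open>Dropping the point 0 from the interval changes nothing in the integral and makes the
  indicator itself a power kernel with exponent 1.\<close>

lemma convol_op_one:
  assumes x: "x \<in> {a..b}" and [measurable]: "\<kappa> \<in> borel_measurable borel" and \<kappa>: "\<And>r. r \<le> 0 \<Longrightarrow> \<kappa> r = 0"
  shows "convol_op \<kappa> (\<lambda>_. 1) x = (\<integral>y. \<kappa> (g x - g a - y) * indicator {0<..g b - g a} y \<partial>lborel)"
proof -
  have "convol_op \<kappa> (\<lambda>_. 1) x = (\<integral>y. indicator {g a..g b} y *\<^sub>R (\<kappa> (g x - y)) \<partial>lborel)"
    unfolding convol_op_def mult_1_right by (rule integral_\<mu>_g) measurable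
  also have "\<dots> = (\<integral>y. indicator {g a..g b} (g a + y) *\<^sub>R (\<kappa> (g x - g a - y)) \<partial>lborel)"
    by (subst lborel_integral_real_affine[of 1 _ "g a"]) (simp_all add: algebra_simps)
  also have "\<dots> = (\<integral>y. \<kappa> (g x - g a - y) * indicator {0<..g b - g a} y \<partial>lborel)"
  proof (rule integral_cong_AE)
    have "AE y in lborel. y \<noteq> (0::real)" by (rule AE_lborel_singleton)
    then show "AE y in lborel. indicator {g a..g b} (g a + y) *\<^sub>R (\<kappa> (g x - g a - y)) =
        \<kappa> (g x - g a - y) * indicator {0<..g b - g a} y"
      by eventually_elim (auto split: split_indicator)
  qed measurable
  finally show ?thesis .
qed

lemma AE_small_increment:
  assumes P: "AE x in \<mu>. P x" and e: "e > 0"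
  shows "\<exists>x\<in>{a..b}. 0 < g x - g a \<and> g x - g a < e \<and> P x"
proof -
  \<comment> \<open>The mean value theorem between two small levels of \<open>g\<close> gives a point with \<open>g' > 0\<close>, and
    continuity spreads it to a set of positive measure.\<close>
  define d where "d = min e (g b - g a)"
  have d: "0 < d" "d \<le> e" "d \<le> g b - g a" using e nonconst by (auto simp: d_def)
  let ?S = "{x \<in> {a<..<b}. g a < g x \<and> g x < g a + d \<and> g' x > 0}"
  have cont: "continuous_on {a..b} g" using g_cont by (rule continuous_on_subset) simp
  obtain x1 where x1: "a \<le> x1" "x1 \<le> b" "g x1 = g a + d / 3"
    using IVT'[of g a "g a + d / 3" b] d ab cont by auto
  obtain x2 where x2: "a \<le> x2" "x2 \<le> b" "g x2 = g a + 2 * d / 3"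
    using IVT'[of g a "g a + 2 * d / 3" b] d ab cont by auto
  have "x1 < x2" using mono[of x2 x1] x1(3) x2(3) d(1) by (cases "x1 < x2") auto
  then obtain z where z: "x1 < z" "z < x2" "g x2 - g x1 = (x2 - x1) * g' z"
    using MVT2[of x1 x2 g g'] deriv by auto
  have "(x2 - x1) * g' z > 0" using z(3) x1(3) x2(3) d(1) by linarith
  then have "g' z > 0" using \<open>x1 < x2\<close> by (simp add: zero_less_mult_iff)
  then have zS: "z \<in> ?S"
    using z(1,2) x1 x2 mono[of x1 z] mono[of z x2] d(1) by auto
  have "open ?S"
  proof -
    have "?S = {a<..<b} \<inter> {x. g a < g x} \<inter> {x. g x < g a + d} \<inter> {x. 0 < g' x}" by auto
    moreover have "open \<dots>"
      using g_cont g'_cont by (intro open_Int open_greaterThanLessThan open_Collect_less continuous_on_const)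
    ultimately show ?thesis by simp
  qed
  then have "\<not> negligible ?S"
    using zS open_not_negligible by blast
  then have "?S \<notin> null_sets lborel"
    unfolding negligible_iff_null_sets using null_sets_completionI by blast
  moreover have [measurable]: "?S \<in> sets borel" using \<open>open ?S\<close> by (rule borel_open)
  ultimately have "\<not> (AE x in lborel. x \<notin> ?S)"
    by (subst AE_iff_null_sets[symmetric]) auto
  moreover have "AE x in lborel. x \<notin> ?S" if "\<not> (\<exists>x\<in>{a..b}. 0 < g x - g a \<and> g x - g a < e \<and> P x)"
    using P unfolding AE_\<mu> by eventually_elim (use that d in fastforce)
  ultimately show ?thesis by blast
qed

end

section \<open>Operators whose kernels are fractional power series\<close>

locale C1_exponent = C1_nondecreasing +
  fixes \<beta> :: complex
  assumes \<beta>: "Re \<beta> > 0"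
begin

sublocale radius_exponent "g b - g a" \<beta>
  by unfold_locales (use nonconst \<beta> in auto)

lemma convol_op_compose_power_kernel:
  assumes "admissible c" "admissible d" "Re p > 0" "Re q > 0" "integrable \<mu> u"
  shows "AE x in \<mu>. convol_op (power_kernel p c) (convol_op (power_kernel q d) u) x =
                    convol_op (power_kernel (p + q) (convolution_coef p c q d)) u x"
  using assms by (intro convol_op_compose) (auto simp: power_kernel_integrable power_kernel_nonpos power_kernel_convolution)

text \<open>The indicator of the half-open interval is \<open>power_kernel 1 \<delta>\<close>, with
  \<open>\<delta>\<close> the coefficients of the constant series 1, so the value on the constant
  function is a special case of the convolution of two kernels.\<close>

lemma convol_op_power_kernel_one:
  assumes x: "x \<in> {a..b}" and c: "admissible c" and p: "Re p > 0"
  shows "convol_op (power_kernel p c) (\<lambda>_. 1) x = power_kernel (p + 1) (\<lambda>k. c k * Beta (\<beta> * of_nat k + p) 1) (g x - g a)"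
proof -
  define \<delta> where "\<delta> n = (if n = 0 then 1 else 0 :: complex)" for n :: nat
  have admissible_\<delta>: "admissible \<delta>"
    unfolding admissible_def \<delta>_def by (rule summable_finite[of "{0}"]) auto
  have power_kernel_\<delta>: "power_kernel 1 \<delta> y = indicator {0<..g b - g a} y" for y
  proof -
    have "(\<Sum>n. \<delta> n * pos_powr (\<beta> * of_nat n + 1 - 1) y) = (\<Sum>n\<in>{0}. \<delta> n * pos_powr (\<beta> * of_nat n + 1 - 1) y)"
      by (rule suminf_finite) (auto simp: \<delta>_def)
    then show ?thesis
      by (auto simp: power_kernel_def \<delta>_def pos_powr_zero pos_powr_nonpos split: split_indicator)
  qed
  have "convolution_coef p c 1 \<delta> k = c k * Beta (\<beta> * of_nat k + p) 1" for k
  proof -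
    have "convolution_coef p c 1 \<delta> k = (\<Sum>i\<le>k. if i = k then c k * Beta (\<beta> * of_nat k + p) 1 else 0)"
      unfolding convolution_coef_def \<delta>_def by (intro sum.cong) auto
    then show ?thesis by simp
  qed
  then have "convolution_coef p c 1 \<delta> = (\<lambda>k. c k * Beta (\<beta> * of_nat k + p) 1)" by (rule ext)
  moreover have "g x - g a \<le> g b - g a" using x mono by simp
  ultimately show ?thesis
    using convol_op_one[OF x, of "power_kernel p c"] power_kernel_convolution(2)[OF c admissible_\<delta> p, of 1 "g x - g a"]
    by (simp add: power_kernel_nonpos power_kernel_\<delta>)
qed

text \<open>\<open>Beta z 1\<close> is \<open>1 / z\<close>, and the real part of
  \<open>\<beta> * k + p\<close> never drops below \<open>Re p\<close>.\<close>

lemma admissible_Beta_one: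
  assumes c: "admissible c" and p: "Re p > 0"
  shows "admissible (\<lambda>k. c k * Beta (\<beta> * of_nat k + p) 1)"
proof -
  have le: "norm (Beta (\<beta> * of_nat k + p) 1) \<le> 1 / Re p" for k
  proof -
    have "Re p \<le> Re (\<beta> * of_nat k + p)" using \<beta> by simp
    then have re: "Re p \<le> norm (\<beta> * of_nat k + p)"
      using complex_Re_le_cmod order_trans by blast
    have pos: "Re (\<beta> * of_nat k + p) > 0" using \<beta> p by (simp add: add_nonneg_pos)
    have "Beta (\<beta> * of_nat k + p) 1 = 1 / (\<beta> * of_nat k + p)"
      using pos by (rule Beta_one_right)
    then show ?thesis using re p by (simp add: norm_divide frac_le)
  qed
  show ?thesis unfolding admissible_def
  proof (rule summable_comparison_test')
    show "summable (\<lambda>k. norm (c k) * (g b - g a) powr (Re \<beta> * k) * (1 / Re p))"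
      using c unfolding admissible_def by (rule summable_mult2)
    show "norm (norm (c k * Beta (\<beta> * of_nat k + p) 1) * (g b - g a) powr (Re \<beta> * k))
        \<le> norm (c k) * (g b - g a) powr (Re \<beta> * k) * (1 / Re p)" for k
      using mult_left_mono[OF le[of k], of "norm (c k) * (g b - g a) powr (Re \<beta> * k)"]
      by (simp add: norm_mult mult_ac)
  qed
qed

text \<open>The constant function is a sufficient test: on it the operator only multiplies the
  \<open>k\<close>-th coefficient by the nonzero number
  \<open>1 / (\<beta> * k + p)\<close>.\<close>

lemma convol_op_power_kernel_unique:
  assumes c: "admissible c" and d: "admissible d" and p: "Re p > 0"
    and ae: "AE x in \<mu>. convol_op (power_kernel p c) (\<lambda>_. 1) x = convol_op (power_kernel p d) (\<lambda>_. 1) x"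
  shows "c = d"
proof -
  let ?C = "\<lambda>c k. c k * Beta (\<beta> * of_nat k + p) 1"
  have "?C c = ?C d"
  proof (rule power_kernel_unique[OF admissible_Beta_one[OF c p] admissible_Beta_one[OF d p]])
    fix e :: real assume "e > 0"
    from AE_small_increment[OF ae this] obtain x where "x \<in> {a..b}" "0 < g x - g a" "g x - g a < e"
      "convol_op (power_kernel p c) (\<lambda>_. 1) x = convol_op (power_kernel p d) (\<lambda>_. 1) x" by blast
    then show "\<exists>r>0. r < e \<and> power_kernel (p + 1) (?C c) r = power_kernel (p + 1) (?C d) r"
      using c d p by (intro exI[of _ "g x - g a"]) (simp add: convol_op_power_kernel_one)
  qed
  moreover have "Beta (\<beta> * of_nat k + p) 1 \<noteq> 0" for k
  proof -
    have pos: "Re (\<beta> * of_nat k + p) > 0"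
      using \<beta> p by (simp add: add_nonneg_pos)
    moreover have "1 / z \<noteq> 0" if "Re z > 0" for z using that by auto
    ultimately show ?thesis unfolding Beta_one_right[OF pos] by blast
  qed
  ultimately show ?thesis by (auto simp: fun_eq_iff)
qed

end

section \<open>Signs, principal branches and the reduction to a nondecreasing function\<close>

text \<open>
  A decreasing \<open>\<phi>\<close> is reduced to an increasing \<open>g\<close> by \<open>\<phi> x - \<phi> t = \<sigma> * (g x - g t)\<close> with \<open>\<sigma> = - 1\<close>;
  the principal branch then only twists the coefficients by powers of \<open>exp w\<close>, where \<open>w = \<i> * pi\<close>.
\<close>

definition sign_log :: "real \<Rightarrow> complex \<Rightarrow> bool" where
  "sign_log \<sigma> w \<longleftrightarrow> \<sigma> = 1 \<and> w = 0 \<or> \<sigma> = - 1 \<and> w = \<i> * of_real pi"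

definition twist :: "complex \<Rightarrow> complex \<Rightarrow> complex \<Rightarrow> (nat \<Rightarrow> complex) \<Rightarrow> nat \<Rightarrow> complex" where
  "twist w \<alpha> \<beta> c n = c n * exp (w * (\<beta> * of_nat n + \<alpha>))"

lemma sign_log_powr:
  assumes "sign_log \<sigma> w" "r > 0"
  shows "complex_of_real (\<sigma> * r) powr z = exp (w * z) * pos_powr z r"
  using assms(1)[unfolded sign_log_def]
proof
  assume "\<sigma> = 1 \<and> w = 0"
  then show ?thesis using assms(2) by (simp add: pos_powr_eq_powr)
next
  assume *: "\<sigma> = - 1 \<and> w = \<i> * of_real pi"
  have "Ln (- complex_of_real r) = of_real (ln r) + \<i> * of_real pi"
    using assms(2) by (subst Ln_minus) (auto simp: Ln_of_real)
  then show ?thesis using assms(2) *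
    by (simp add: powr_def pos_powr_def exp_add[symmetric] algebra_simps)
qed

lemma exp_sign_log: "sign_log \<sigma> w \<Longrightarrow> exp w = of_real \<sigma>" "sign_log \<sigma> w \<Longrightarrow> \<sigma> * \<sigma> = 1"
  by (auto simp: sign_log_def exp_Euler)

context C1_exponent
begin

lemma analytic_kernel_integral_eq:
  fixes \<A> :: "complex \<Rightarrow> complex \<Rightarrow> complex \<Rightarrow> complex"
  assumes \<sigma>: "sign_log \<sigma> w"
    and \<phi>: "\<And>s t. s \<in> {a..b} \<Longrightarrow> t \<in> {a..b} \<Longrightarrow> \<phi> s - \<phi> t = \<sigma> * (g s - g t)"
    and \<phi>': "\<And>t. t \<in> {a..b} \<Longrightarrow> \<phi>' t = \<sigma> * g' t"
    and \<A>: "\<And>r. 0 < r \<Longrightarrow> r \<le> g b - g a \<Longrightarrow>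
      (\<lambda>n. c n * (complex_of_real (\<sigma> * r) powr \<beta>) ^ n) sums \<A> \<alpha> \<beta> (complex_of_real (\<sigma> * r) powr \<beta>)"
    and u: "u \<in> borel_measurable (lebesgue_on {a..b})"
    and [measurable]: "v \<in> borel_measurable borel"
    and uv: "AE t in lborel. t \<in> {a..b} \<longrightarrow> u t = v t"
    and x: "x \<in> {a..b}"
  shows "analytic_kernel_integral \<A> a \<phi> \<phi>' \<alpha> \<beta> u x = convol_op (power_kernel \<alpha> (twist w \<alpha> \<beta> c)) v x"
proof -
  let ?\<kappa> = "power_kernel \<alpha> (twist w \<alpha> \<beta> c)"
  have kernel: "complex_of_real (\<phi>' t) * complex_of_real (\<phi> x - \<phi> t) powr (\<alpha> - 1)
          * \<A> \<alpha> \<beta> (complex_of_real (\<phi> x - \<phi> t) powr \<beta>) = of_real (g' t) * ?\<kappa> (g x - g t)"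
    if t: "t \<in> {a..x}" for t
  proof (cases "g x - g t = 0")
    \<comment> \<open>Here \<open>0 powr z\<close> is 0 for every \<open>z\<close>, even
      \<open>z = 0\<close>, which agrees with the kernel vanishing at 0.\<close>
    case True
    moreover have "\<phi> x - \<phi> t = 0" using \<phi>[of x t] x t True by simp
    ultimately show ?thesis by (simp add: power_kernel_nonpos)
  next
    case False
    define r where "r = g x - g t"
    have r: "0 < r" "r \<le> g b - g a"
      using mono[of t x] mono[of a t] mono[of x b] t x False by (auto simp: r_def)
    have \<phi>r: "\<phi> x - \<phi> t = \<sigma> * r" using \<phi>[of x t] x t by (simp add: r_def)
    have "(\<lambda>n. c n * (exp (w * \<beta>) * pos_powr \<beta> r) ^ n * (exp (w * \<alpha>) * pos_powr (\<alpha> - 1) r)) sums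
          (\<A> \<alpha> \<beta> (complex_of_real (\<sigma> * r) powr \<beta>) * (exp (w * \<alpha>) * pos_powr (\<alpha> - 1) r))"
      using \<A>[OF r] unfolding sign_log_powr[OF \<sigma> r(1)] by (rule sums_mult2)
    moreover have "c n * (exp (w * \<beta>) * pos_powr \<beta> r) ^ n * (exp (w * \<alpha>) * pos_powr (\<alpha> - 1) r) =
        twist w \<alpha> \<beta> c n * pos_powr (\<beta> * of_nat n + \<alpha> - 1) r" for n
      unfolding twist_def add_diff_eq[symmetric] pos_powr_add pos_powr_of_nat_mult[OF r(1)]
      by (simp add: power_mult_distrib exp_of_nat_mult[symmetric] exp_add[symmetric] algebra_simps)
    ultimately have \<kappa>: "?\<kappa> r = \<A> \<alpha> \<beta> (complex_of_real (\<sigma> * r) powr \<beta>) * (exp (w * \<alpha>) * pos_powr (\<alpha> - 1) r)"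
      using r(2) by (simp add: power_kernel_def sums_iff)
    have "of_real (\<phi>' t) * complex_of_real (\<sigma> * r) powr (\<alpha> - 1) = of_real (g' t) * (of_real \<sigma> * exp (w * (\<alpha> - 1))) * pos_powr (\<alpha> - 1) r"
    proof -
      have "\<phi>' t = \<sigma> * g' t" using \<phi>'[of t] t x by simp
      then show ?thesis unfolding sign_log_powr[OF \<sigma> r(1)] by simp
    qed
    \<comment> \<open>As \<open>\<sigma> = exp w\<close>, the sign of \<open>\<phi>'\<close> raises
      the exponent of the branch factor from \<open>\<alpha> - 1\<close> to the
      \<open>\<alpha>\<close> used in \<open>twist\<close>.\<close>
    also have "of_real \<sigma> * exp (w * (\<alpha> - 1)) = exp (w * \<alpha>)"
      unfolding exp_sign_log(1)[OF \<sigma>, symmetric] by (simp add: exp_add[symmetric] algebra_simps)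
    finally show ?thesis unfolding \<phi>r r_def[symmetric] \<kappa> by (simp add: mult_ac)
  qed
  \<comment> \<open>The upper limit \<open>x\<close> may become \<open>b\<close>: for
    \<open>t > x\<close> the increment \<open>g x - g t\<close> is nonpositive, where the kernel
    vanishes.\<close>
  have eq: "indicator {a..x} t *\<^sub>R (complex_of_real (\<phi>' t) * complex_of_real (\<phi> x - \<phi> t) powr (\<alpha> - 1)
          * \<A> \<alpha> \<beta> (complex_of_real (\<phi> x - \<phi> t) powr \<beta>) * u t) =
        (indicator {a..b} t * g' t) *\<^sub>R (?\<kappa> (g x - g t) * (indicator {a..b} t *\<^sub>R u t))" for t
  proof (cases "t \<in> {a..x}")
    case True
    then have "indicator {a..x} t = (1 :: real)" "indicator {a..b} t = (1 :: real)" using x by auto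
    then show ?thesis unfolding kernel[OF True] by (simp add: scaleR_conv_of_real)
  next
    case False
    then show ?thesis using mono[of x t] x by (auto simp: power_kernel_nonpos split: split_indicator)
  qed
  have [measurable]: "(\<lambda>t. indicator {a..b} t *\<^sub>R u t) \<in> borel_measurable lebesgue"
    using u by (subst borel_measurable_restrict_space_iff[symmetric]) auto
  have [measurable]: "(\<lambda>t. ?\<kappa> (g x - g t)) \<in> borel_measurable lebesgue"
    by (rule measurable_completion) measurable
  have [measurable]: "(\<lambda>t. indicator {a..b} t * g' t) \<in> borel_measurable lebesgue"
    by (rule measurable_completion) measurable
  have [measurable]: "v \<in> borel_measurable lebesgue"
    by (rule measurable_completion) measurable
  have "analytic_kernel_integral \<A> a \<phi> \<phi>' \<alpha> \<beta> u x =
      (\<integral>t. (indicator {a..b} t * g' t) *\<^sub>R (?\<kappa> (g x - g t) * (indicator {a..b} t *\<^sub>R u t)) \<partial>lebesgue)"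
    unfolding analytic_kernel_integral_def set_lebesgue_integral_def eq ..
  also have "\<dots> = (\<integral>t. (indicator {a..b} t * g' t) *\<^sub>R (?\<kappa> (g x - g t) * v t) \<partial>lebesgue)"
  proof (rule integral_cong_AE)
    show "AE t in lebesgue. (indicator {a..b} t * g' t) *\<^sub>R (?\<kappa> (g x - g t) * (indicator {a..b} t *\<^sub>R u t)) =
        (indicator {a..b} t * g' t) *\<^sub>R (?\<kappa> (g x - g t) * v t)"
      using AE_completion[OF uv] by eventually_elim (auto split: split_indicator)
  qed measurable
  also have "\<dots> = (\<integral>t. (indicator {a..b} t * g' t) *\<^sub>R (?\<kappa> (g x - g t) * v t) \<partial>lborel)"
    by (rule integral_completion) measurable
  also have "\<dots> = convol_op ?\<kappa> v x"
    unfolding convol_op_def by (rule integral_\<mu>[symmetric]) measurable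
  finally show ?thesis .
qed

end

text \<open>Members of the weighted space are only Lebesgue measurable, while \<open>\<mu>\<close>
  lives on Borel sets. A change on a null set leaves the operators unaffected.\<close>

lemma Borel_version:
  assumes u: "(u :: real \<Rightarrow> complex) \<in> borel_measurable (lebesgue_on {a..b})"
  obtains v where "v \<in> borel_measurable borel" "AE t in lborel. t \<in> {a..b} \<longrightarrow> u t = v t"
proof -
  have m [measurable]: "(\<lambda>t. indicator {a..b} t *\<^sub>R u t) \<in> borel_measurable lebesgue"
    using u by (subst borel_measurable_restrict_space_iff[symmetric]) auto
  have re: "(\<lambda>t. Re (indicator {a..b} t *\<^sub>R u t)) \<in> borel_measurable lebesgue"
    and im: "(\<lambda>t. Im (indicator {a..b} t *\<^sub>R u t)) \<in> borel_measurable lebesgue"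
    using m by (simp_all only: borel_measurable_complex_iff)
  obtain f where f: "f \<in> borel_measurable lborel" "AE t in lborel. Re (indicator {a..b} t *\<^sub>R u t) = f t"
    using completion_ex_borel_measurable_real[OF re] by blast
  obtain h where h: "h \<in> borel_measurable lborel" "AE t in lborel. Im (indicator {a..b} t *\<^sub>R u t) = h t"
    using completion_ex_borel_measurable_real[OF im] by blast
  show thesis
  proof (rule that[of "\<lambda>t. Complex (f t) (h t)"])
    have [measurable]: "f \<in> borel_measurable borel" "h \<in> borel_measurable borel" using f h by simp_all
    show "(\<lambda>t. Complex (f t) (h t)) \<in> borel_measurable borel"
      unfolding borel_measurable_complex_iff by simp
    show "AE t in lborel. t \<in> {a..b} \<longrightarrow> u t = Complex (f t) (h t)"
      using f(2) h(2) by eventually_elim (auto simp: complex_eq_iff)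
  qed
qed

text \<open>For \<open>i + j = k\<close> the branch factors multiply to one exponential and the Beta
  values share one Gamma denominator. Both are nonzero and independent of \<open>i\<close>, so the
  condition is the same for increasing and decreasing functions.\<close>

lemma twist_convolution_coef_iff:
  fixes coef :: "complex \<Rightarrow> complex \<Rightarrow> nat \<Rightarrow> complex"
  assumes "Re \<beta> > 0" "Re \<alpha> > 0" "Re \<gamma> > 0"
  shows "radius_exponent.convolution_coef \<beta> \<alpha> (twist w \<alpha> \<beta> c) \<gamma> (twist w \<gamma> \<beta> d) k = twist w (\<alpha> + \<gamma>) \<beta> h k \<longleftrightarrow>
     h k * Gamma (\<beta> * of_nat k + \<alpha> + \<gamma>) =
        (\<Sum>(m, n) \<in> {(m, n). m + n = k}.
           c n * d m * Gamma (\<beta> * of_nat n + \<alpha>) * Gamma (\<beta> * of_nat m + \<gamma>))"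
proof -
  \<comment> \<open>The radius 1 is an arbitrary choice, since \<open>convolution_coef\<close> does
    not depend on it.\<close>
  interpret radius_exponent 1 \<beta> by unfold_locales (use assms in auto)
  let ?S = "\<Sum>i\<le>k. c i * d (k - i) * Gamma (\<beta> * of_nat i + \<alpha>) * Gamma (\<beta> * of_nat (k - i) + \<gamma>)"
  let ?E = "exp (w * (\<beta> * of_nat k + (\<alpha> + \<gamma>)))"
  let ?G = "Gamma (\<beta> * of_nat k + \<alpha> + \<gamma>)"
  have "Re (\<beta> * of_nat k + \<alpha> + \<gamma>) > 0" using assms by (simp add: add_nonneg_pos)
  then have G: "?G \<noteq> 0" by (rule Gamma_nonzero_Re_pos)
  have S: "(\<Sum>(m, n) \<in> {(m, n). m + n = k}. c n * d m * Gamma (\<beta> * of_nat n + \<alpha>) * Gamma (\<beta> * of_nat m + \<gamma>)) = ?S"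
    by (rule sum.reindex_bij_witness[of _ "\<lambda>i. (k - i, i)" snd]) auto
  have "twist w \<alpha> \<beta> c i * twist w \<gamma> \<beta> d (k - i) * Beta (\<beta> * of_nat i + \<alpha>) (\<beta> * of_nat (k - i) + \<gamma>) =
      ?E / ?G * (c i * d (k - i) * Gamma (\<beta> * of_nat i + \<alpha>) * Gamma (\<beta> * of_nat (k - i) + \<gamma>))" if i: "i \<le> k" for i
  proof -
    have sum: "\<beta> * of_nat i + \<alpha> + (\<beta> * of_nat (k - i) + \<gamma>) = \<beta> * of_nat k + \<alpha> + \<gamma>"
      using i by (simp add: of_nat_diff algebra_simps)
    have "exp (w * (\<beta> * of_nat i + \<alpha>)) * exp (w * (\<beta> * of_nat (k - i) + \<gamma>)) = ?E"
      unfolding exp_add[symmetric] distrib_left[symmetric] sum by (simp add: add.assoc)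
    then show ?thesis unfolding twist_def Beta_def sum by (simp add: mult_ac)
  qed
  then have "convolution_coef \<alpha> (twist w \<alpha> \<beta> c) \<gamma> (twist w \<gamma> \<beta> d) k = ?E / ?G * ?S"
    unfolding convolution_coef_def sum_distrib_left by (intro sum.cong) auto
  moreover have "e / f * s = y * e \<longleftrightarrow> y * f = s" if "e \<noteq> 0" "f \<noteq> 0" for e f s y :: complex
    using that by (auto simp: field_simps)
  ultimately show ?thesis
    unfolding S twist_def[of _ _ _ h] using G by simp
qed

text \<open>Clamping the argument to the interval continues \<open>\<sigma> * \<phi>'\<close> by
  constants, and \<open>g\<close> is an antiderivative on the line. On the interval it differs from
  \<open>\<sigma> * \<phi>\<close> by a constant, which drops out of increments.\<close>

lemma nondecreasing_extension:
  fixes \<phi> \<phi>' :: "real \<Rightarrow> real"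
  assumes ab: "a < b"
    and \<phi>: "\<And>x. x \<in> {a..b} \<Longrightarrow> (\<phi> has_real_derivative \<phi>' x) (at x within {a..b})"
    and \<phi>'_cont: "continuous_on {a..b} \<phi>'"
    and mono: "mono_on {a..b} (\<lambda>x. \<sigma> * \<phi> x)" and \<sigma>: "\<sigma> * \<sigma> = 1"
    and nonconst: "\<not> \<phi> constant_on {a..b}"
  obtains g g' where "C1_nondecreasing a b g g'"
    "\<And>s t. s \<in> {a..b} \<Longrightarrow> t \<in> {a..b} \<Longrightarrow> \<phi> s - \<phi> t = \<sigma> * (g s - g t)"
    "\<And>t. t \<in> {a..b} \<Longrightarrow> \<phi>' t = \<sigma> * g' t"
proof -
  define g' where "g' t = \<sigma> * \<phi>' (max a (min b t))" for t
  have clamp: "max a (min b t) \<in> {a..b}" for t using ab by auto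
  have g'_cont: "continuous_on UNIV g'"
    unfolding g'_def using clamp
    by (intro continuous_intros continuous_on_compose2[OF \<phi>'_cont]) auto
  have g'_eq: "g' t = \<sigma> * \<phi>' t" if "t \<in> {a..b}" for t
  proof -
    have "max a (min b t) = t" using that by auto
    then show ?thesis by (simp add: g'_def)
  qed
  have deriv: "((\<lambda>x. \<sigma> * \<phi> x) has_real_derivative \<sigma> * \<phi>' x) (at x within {a..b})" if "x \<in> {a..b}" for x
    using \<phi>[OF that] by (rule DERIV_cmult)
  have "\<sigma> * \<phi>' x \<ge> 0" if "x \<in> {a..b}" for x
  \<comment> \<open>Monotonicity gives the sign at interior points, where the derivative is
    two-sided; continuity extends it to the end points.\<close>
  proof (rule continuous_ge_on_closure[where S = "{a<..<b}" and f = "\<lambda>x. \<sigma> * \<phi>' x"])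
    show "continuous_on (closure {a<..<b}) (\<lambda>x. \<sigma> * \<phi>' x)"
      using \<phi>'_cont ab by (auto intro: continuous_intros)
    show "x \<in> closure {a<..<b}" using that ab by simp
    show "0 \<le> \<sigma> * \<phi>' y" if "y \<in> {a<..<b}" for y
    proof (rule mono_on_imp_deriv_nonneg[OF mono])
      show "((\<lambda>x. \<sigma> * \<phi> x) has_real_derivative \<sigma> * \<phi>' y) (at y)"
        using deriv[of y] that by (simp add: at_within_Icc_at)
    qed (use that in simp)
  qed
  then have g'_nonneg: "g' t \<ge> 0" for t using clamp by (simp add: g'_def)
  obtain g where "\<And>x. (g has_vector_derivative g' x) (at x)"
    using einterval_antiderivative[of "-\<infinity>" \<infinity> g'] g'_cont by (auto simp: continuous_on_eq_continuous_at)
  then have g: "(g has_real_derivative g' x) (at x)" for x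
    by (simp add: has_real_derivative_iff_has_vector_derivative)
  have "\<exists>c. \<forall>x\<in>{a..b}. \<sigma> * \<phi> x - g x = c"
  proof (rule has_field_derivative_zero_constant)
    show "((\<lambda>x. \<sigma> * \<phi> x - g x) has_field_derivative 0) (at x within {a..b})" if "x \<in> {a..b}" for x
      using DERIV_diff[OF deriv[OF that] has_field_derivative_at_within[OF g[of x]]] g'_eq[OF that] by simp
  qed simp
  then obtain c where c: "\<And>x. x \<in> {a..b} \<Longrightarrow> \<sigma> * \<phi> x = g x + c" by (auto simp: algebra_simps)
  have \<phi>_g: "\<phi> x = \<sigma> * (g x + c)" if "x \<in> {a..b}" for x
    unfolding c[OF that, symmetric] using \<sigma> by (simp add: mult.assoc[symmetric])
  have g_mono: "g x \<le> g y" if "x \<le> y" for x y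
    using that g g'_nonneg by (meson DERIV_nonneg_imp_nondecreasing)
  have "g a < g b"
  proof (rule ccontr)
    assume "\<not> g a < g b"
    then have "\<phi> x = \<sigma> * (g a + c)" if "x \<in> {a..b}" for x
      using g_mono[of a x] g_mono[of x b] \<phi>_g[OF that] that by auto
    then have "\<phi> constant_on {a..b}"
      unfolding constant_on_def by blast
    with nonconst show False by contradiction
  qed
  then show thesis
  proof (intro that[of g g'] C1_nondecreasing.intro)
    show "\<phi> s - \<phi> t = \<sigma> * (g s - g t)" if "s \<in> {a..b}" "t \<in> {a..b}" for s t
      using that by (simp add: \<phi>_g algebra_simps)
    show "\<phi>' t = \<sigma> * g' t" if "t \<in> {a..b}" for t
      using g'_eq[OF that] \<sigma> by (simp add: mult.assoc[symmetric])
  qed (use ab g g'_cont g'_nonneg in auto)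
qed

text \<open>The point \<open>?z\<close> is the kernel argument at the full increment, and its powers
  already contain the branch factors of \<open>twist\<close>. Absolute convergence there, from
  convergence at some \<open>s\<close> between its norm and \<open>R\<close>, is therefore
  admissibility of the twisted sequence.\<close>

lemma (in C1_exponent) admissible_twist:
  assumes \<sigma>: "sign_log \<sigma> w" and R: "norm (complex_of_real (\<sigma> * (g b - g a)) powr \<beta>) < R"
    and sums: "\<And>z. z \<in> ball 0 R \<Longrightarrow> summable (\<lambda>n. c n * z ^ n)"
  shows "admissible (twist w \<alpha> \<beta> c)"
proof -
  let ?z = "complex_of_real (\<sigma> * (g b - g a)) powr \<beta>"
  obtain s where s: "norm ?z < s" "s < R" using R dense by blast
  have s0: "s > 0" using order_le_less_trans[OF norm_ge_zero s(1)] .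
  then have "norm ?z < norm (complex_of_real s)" using s by simp
  moreover have "summable (\<lambda>n. c n * of_real s ^ n)"
    using s s0 by (intro sums) simp
  ultimately have "summable (\<lambda>n. norm (c n * ?z ^ n))" using powser_insidea by blast
  then have "summable (\<lambda>n. norm (c n * ?z ^ n) * norm (exp (w * \<alpha>)))" by (rule summable_mult2)
  moreover have "norm (c n * ?z ^ n) * norm (exp (w * \<alpha>)) =
      norm (twist w \<alpha> \<beta> c n) * (g b - g a) powr (Re \<beta> * n)" for n
  proof -
    have "norm (pos_powr (\<beta> * of_nat n) (g b - g a)) = (g b - g a) powr (Re \<beta> * n)"
      using nonconst by (simp add: norm_pos_powr)
    moreover have "?z ^ n = exp (w * (\<beta> * of_nat n)) * pos_powr (\<beta> * of_nat n) (g b - g a)"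
      using nonconst by (simp add: sign_log_powr[OF \<sigma>] power_mult_distrib pos_powr_of_nat_mult
        exp_of_nat_mult[symmetric] mult_ac del: of_real_mult of_real_diff)
    moreover have "twist w \<alpha> \<beta> c n = c n * (exp (w * (\<beta> * of_nat n)) * exp (w * \<alpha>))"
      by (simp add: twist_def exp_add[symmetric] distrib_left)
    ultimately show ?thesis by (simp add: norm_mult mult_ac)
  qed
  ultimately show ?thesis by (simp add: admissible_def)
qed

lemma (in C1_nondecreasing) L1_weighted_integrable:
  assumes u: "u \<in> L1_weighted a b \<phi>'" and \<phi>': "\<And>t. t \<in> {a..b} \<Longrightarrow> \<phi>' t = \<sigma> * g' t" and \<sigma>: "\<sigma> * \<sigma> = 1"
    and v [measurable]: "v \<in> borel_measurable borel"
    and uv: "AE t in lborel. t \<in> {a..b} \<longrightarrow> u t = v t"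
  shows "integrable \<mu> v"
proof -
  have abs_\<sigma>: "\<bar>\<sigma>\<bar> = 1" using \<sigma> by (metis abs_mult_self_eq abs_1 abs_mult abs_ge_zero square_eq_1_iff abs_minus_cancel)
  have "integrable lebesgue (\<lambda>t. indicator {a..b} t *\<^sub>R (norm (u t) * \<phi>' t))"
    using u unfolding L1_weighted_def by (simp add: integrable_restrict_space)
  then have "integrable lebesgue (\<lambda>t. (indicator {a..b} t * g' t) *\<^sub>R v t)"
  proof (rule Bochner_Integration.integrable_bound)
    show "(\<lambda>t. (indicator {a..b} t * g' t) *\<^sub>R v t) \<in> borel_measurable lebesgue"
      by (rule measurable_completion) measurable
    show "AE t in lebesgue. norm ((indicator {a..b} t * g' t) *\<^sub>R v t) \<le> norm (indicator {a..b} t *\<^sub>R (norm (u t) * \<phi>' t))"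
      using AE_completion[OF uv] by eventually_elim (auto simp: \<phi>' abs_mult abs_\<sigma> split: split_indicator)
  qed
  then have "integrable lborel (\<lambda>t. (indicator {a..b} t * g' t) *\<^sub>R v t)"
    by (subst (asm) integrable_completion) measurable
  then show ?thesis by (simp add: integrable_\<mu>)
qed

lemma (in C1_nondecreasing) L1_weighted_eq_iff:
  assumes "\<And>t. t \<in> {a..b} \<Longrightarrow> \<phi>' t = \<sigma> * g' t" and "\<sigma> * \<sigma> = 1"
    and "\<And>t. t \<in> {a..b} \<Longrightarrow> f t = f' t" "\<And>t. t \<in> {a..b} \<Longrightarrow> h t = h' t"
  shows "L1_weighted_eq a b \<phi>' f h \<longleftrightarrow> (AE x in \<mu>. f' x = h' x)"
proof -
  have "\<sigma> \<noteq> 0" using assms(2) by auto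
  then have "(t \<in> {a..b} \<longrightarrow> \<phi>' t \<noteq> 0 \<longrightarrow> f t = h t) \<longleftrightarrow> (t \<in> {a..b} \<and> g' t > 0 \<longrightarrow> f' t = h' t)" for t
    using assms g'_nonneg[of t] by (auto simp: less_le)
  then show ?thesis
    unfolding L1_weighted_eq_def AE_\<mu> by (simp add: AE_restrict_space_iff AE_completion_iff)
qed

section \<open>Semigroup property and coefficient condition\<close>

theorem theorem3p7:
  fixes a b :: real
    and \<phi> \<phi>' :: "real \<Rightarrow> real"
    and coef :: "complex \<Rightarrow> complex \<Rightarrow> nat \<Rightarrow> complex"
    and \<A> :: "complex \<Rightarrow> complex \<Rightarrow> complex \<Rightarrow> complex"
    and R :: "complex \<Rightarrow> complex \<Rightarrow> real"
  assumes "a < b"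
    and \<phi>_deriv: "\<And>x. x \<in> {a..b} \<Longrightarrow> (\<phi> has_real_derivative \<phi>' x) (at x within {a..b})"
    and \<phi>'_cont: "continuous_on {a..b} \<phi>'"
    and \<phi>_monotonic: "mono_on {a..b} \<phi> \<or> antimono_on {a..b} \<phi>"
    and \<phi>_nonconstant: "\<not> \<phi> constant_on {a..b}"
    and radius: "\<And>\<alpha> \<beta>. Re \<alpha> > 0 \<Longrightarrow> Re \<beta> > 0 \<Longrightarrow> R \<alpha> \<beta> > (b - a) powr Re \<beta>"
    and kernel_argument_in_disc:
      "\<And>\<alpha> \<beta> x t. Re \<alpha> > 0 \<Longrightarrow> Re \<beta> > 0 \<Longrightarrow> a \<le> t \<Longrightarrow> t \<le> x \<Longrightarrow> x \<le> b \<Longrightarrow>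
         complex_of_real (\<phi> x - \<phi> t) powr \<beta> \<in> ball 0 (R \<alpha> \<beta>)"
    and analytic: "\<And>\<alpha> \<beta>. Re \<alpha> > 0 \<Longrightarrow> Re \<beta> > 0 \<Longrightarrow> \<A> \<alpha> \<beta> analytic_on ball 0 (R \<alpha> \<beta>)"
    and power_series: "\<And>\<alpha> \<beta> z. Re \<alpha> > 0 \<Longrightarrow> Re \<beta> > 0 \<Longrightarrow> z \<in> ball 0 (R \<alpha> \<beta>) \<Longrightarrow>
         (\<lambda>n. coef \<alpha> \<beta> n * z ^ n) sums \<A> \<alpha> \<beta> z"
  shows
    "(\<forall>\<alpha> \<beta> \<gamma>. \<forall>u \<in> L1_weighted a b \<phi>'. Re \<alpha> > 0 \<longrightarrow> Re \<beta> > 0 \<longrightarrow> Re \<gamma> > 0 \<longrightarrow>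
        L1_weighted_eq a b \<phi>'
          ((analytic_kernel_integral \<A> a \<phi> \<phi>' \<alpha> \<beta> \<circ> analytic_kernel_integral \<A> a \<phi> \<phi>' \<gamma> \<beta>) u)
          (analytic_kernel_integral \<A> a \<phi> \<phi>' (\<alpha> + \<gamma>) \<beta> u))
     \<longleftrightarrow>
     (\<forall>\<alpha> \<beta> \<gamma>. \<forall>k::nat. Re \<alpha> > 0 \<longrightarrow> Re \<beta> > 0 \<longrightarrow> Re \<gamma> > 0 \<longrightarrow>
        coef (\<alpha> + \<gamma>) \<beta> k * Gamma (\<beta> * of_nat k + \<alpha> + \<gamma>) =
        (\<Sum>(m, n) \<in> {(m, n). m + n = k}.
           coef \<alpha> \<beta> n * coef \<gamma> \<beta> m * Gamma (\<beta> * of_nat n + \<alpha>) * Gamma (\<beta> * of_nat m + \<gamma>)))"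
proof -
  obtain \<sigma> w where \<sigma>: "sign_log \<sigma> w" and mono: "mono_on {a..b} (\<lambda>x. \<sigma> * \<phi> x)"
    using \<phi>_monotonic
  proof
    assume "mono_on {a..b} \<phi>"
    then show thesis by (intro that[of 1 0]) (simp_all add: sign_log_def)
  next
    assume "antimono_on {a..b} \<phi>"
    then have "mono_on {a..b} (\<lambda>x. - 1 * \<phi> x)"
      by (auto simp: monotone_on_def)
    then show thesis by (rule that[rotated]) (simp add: sign_log_def)
  qed
  note \<sigma>\<sigma> = exp_sign_log(2)[OF \<sigma>]
  obtain g g' where "C1_nondecreasing a b g g'"
    and \<phi>_g: "\<And>s t. s \<in> {a..b} \<Longrightarrow> t \<in> {a..b} \<Longrightarrow> \<phi> s - \<phi> t = \<sigma> * (g s - g t)"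
    and \<phi>'_g': "\<And>t. t \<in> {a..b} \<Longrightarrow> \<phi>' t = \<sigma> * g' t"
    using nondecreasing_extension[OF \<open>a < b\<close> \<phi>_deriv \<phi>'_cont mono \<sigma>\<sigma> \<phi>_nonconstant] by blast
  then interpret C1_nondecreasing a b g g' by simp
  \<comment> \<open>The equivalence is proved for each triple of parameters separately; quantifying
    over the triples then gives the uniform one.\<close>
  have "(\<forall>u \<in> L1_weighted a b \<phi>'. L1_weighted_eq a b \<phi>'
          ((analytic_kernel_integral \<A> a \<phi> \<phi>' \<alpha> \<beta> \<circ> analytic_kernel_integral \<A> a \<phi> \<phi>' \<gamma> \<beta>) u)
          (analytic_kernel_integral \<A> a \<phi> \<phi>' (\<alpha> + \<gamma>) \<beta> u)) \<longleftrightarrow>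
     (\<forall>k. coef (\<alpha> + \<gamma>) \<beta> k * Gamma (\<beta> * of_nat k + \<alpha> + \<gamma>) =
        (\<Sum>(m, n) \<in> {(m, n). m + n = k}.
           coef \<alpha> \<beta> n * coef \<gamma> \<beta> m * Gamma (\<beta> * of_nat n + \<alpha>) * Gamma (\<beta> * of_nat m + \<gamma>)))"
    (is "(\<forall>u \<in> ?L. ?semigroup u) \<longleftrightarrow> ?coefs")
    if \<alpha>: "Re \<alpha> > 0" and \<beta>: "Re \<beta> > 0" and \<gamma>: "Re \<gamma> > 0" for \<alpha> \<beta> \<gamma>
  proof -
    interpret C1_exponent a b g g' \<beta> by unfold_locales fact
    define c where "c p = twist w p \<beta> (coef p \<beta>)" for p
    have \<alpha>\<gamma>: "Re (\<alpha> + \<gamma>) > 0" using \<alpha> \<gamma> by simp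
    \<comment> \<open>By the intermediate value theorem every such \<open>r\<close> is an increment
      \<open>g x - g a\<close>, so the assumption on kernel arguments covers it with
      \<open>t = a\<close>.\<close>
    have in_disc: "complex_of_real (\<sigma> * r) powr \<beta> \<in> ball 0 (R p \<beta>)"
      if r: "0 < r" "r \<le> g b - g a" and p: "Re p > 0" for r p
    proof -
      obtain x where "a \<le> x" "x \<le> b" "g x = g a + r"
        using IVT'[of g a "g a + r" b] r ab continuous_on_subset[OF g_cont] by auto
      then show ?thesis
        using kernel_argument_in_disc[OF p \<beta>, of a x] \<phi>_g[of x a] ab by simp
    qed
    have admissible: "admissible (c p)" if p: "Re p > 0" for p
      unfolding c_def
    proof (rule admissible_twist[OF \<sigma>])
      show "norm (complex_of_real (\<sigma> * (g b - g a)) powr \<beta>) < R p \<beta>"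
        using in_disc[of "g b - g a" p] nonconst p by simp
      show "summable (\<lambda>n. coef p \<beta> n * z ^ n)" if "z \<in> ball 0 (R p \<beta>)" for z
        using power_series[OF p \<beta> that] by (rule sums_summable)
    qed
    have op: "analytic_kernel_integral \<A> a \<phi> \<phi>' p \<beta> u x = convol_op (power_kernel p (c p)) v x"
      if "Re p > 0" "u \<in> borel_measurable (lebesgue_on {a..b})" "v \<in> borel_measurable borel"
        "AE t in lborel. t \<in> {a..b} \<longrightarrow> u t = v t" "x \<in> {a..b}" for p u v x
      unfolding c_def using that
      by (intro analytic_kernel_integral_eq[OF \<sigma> \<phi>_g \<phi>'_g'] power_series in_disc \<beta>)
    \<comment> \<open>The inner operator agrees on all of \<open>{a..b}\<close> with the Borel
      function \<open>?v\<close>, so \<open>op\<close> can be applied again to the outer one;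
      composing the kernels then leaves two operators with the same exponent.\<close>
    have transfer: "?semigroup u \<longleftrightarrow>
        (AE x in \<mu>. convol_op (power_kernel (\<alpha> + \<gamma>) (convolution_coef \<alpha> (c \<alpha>) \<gamma> (c \<gamma>))) v x = convol_op (power_kernel (\<alpha> + \<gamma>) (c (\<alpha> + \<gamma>))) v x)"
      if u: "u \<in> ?L" and v: "v \<in> borel_measurable borel" and uv: "AE t in lborel. t \<in> {a..b} \<longrightarrow> u t = v t" for u v
    proof -
      have u_meas: "u \<in> borel_measurable (lebesgue_on {a..b})"
        using u by (simp add: L1_weighted_def)
      have v_int: "integrable \<mu> v"
        using L1_weighted_integrable[OF u \<phi>'_g' \<sigma>\<sigma> v uv] .
      let ?v = "convol_op (power_kernel \<gamma> (c \<gamma>)) v"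
      have v'[measurable]: "?v \<in> borel_measurable borel" using v by measurable
      have inner: "analytic_kernel_integral \<A> a \<phi> \<phi>' \<gamma> \<beta> u x = ?v x" if "x \<in> {a..b}" for x
        using op[OF \<gamma> u_meas v uv that] .
      have "?v \<in> borel_measurable (lebesgue_on {a..b})"
        by (intro measurable_restrict_space1 measurable_completion) measurable
      then have inner_meas: "analytic_kernel_integral \<A> a \<phi> \<phi>' \<gamma> \<beta> u \<in> borel_measurable (lebesgue_on {a..b})"
        using inner by (subst measurable_cong[of _ _ ?v]) (auto simp: space_restrict_space)
      have "?semigroup u \<longleftrightarrow> (AE x in \<mu>. convol_op (power_kernel \<alpha> (c \<alpha>)) ?v x = convol_op (power_kernel (\<alpha> + \<gamma>) (c (\<alpha> + \<gamma>))) v x)"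
        using inner op[OF \<alpha> inner_meas v'] op[OF \<alpha>\<gamma> u_meas v uv]
        by (intro L1_weighted_eq_iff[OF \<phi>'_g' \<sigma>\<sigma>]) auto
      also have "\<dots> \<longleftrightarrow>
        (AE x in \<mu>. convol_op (power_kernel (\<alpha> + \<gamma>) (convolution_coef \<alpha> (c \<alpha>) \<gamma> (c \<gamma>))) v x = convol_op (power_kernel (\<alpha> + \<gamma>) (c (\<alpha> + \<gamma>))) v x)"
        using convol_op_compose_power_kernel[OF admissible[OF \<alpha>] admissible[OF \<gamma>] \<alpha> \<gamma> v_int]
        by (intro AE_cong_simp refl eventually_subst) (auto elim!: eventually_mono)
      finally show ?thesis .
    qed
    have one: "(\<lambda>_. 1) \<in> ?L"
    proof -
      have "integrable (lebesgue_on {a..b}) \<phi>'"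
        using \<phi>'_cont continuous_imp_integrable_real by blast
      then show ?thesis by (simp add: L1_weighted_def)
    qed
    \<comment> \<open>Forward, \<open>u = 1\<close> alone identifies the coefficients; backward,
      equal coefficients make both sides the same operator.\<close>
    have "(\<forall>u \<in> ?L. ?semigroup u) \<longleftrightarrow> convolution_coef \<alpha> (c \<alpha>) \<gamma> (c \<gamma>) = c (\<alpha> + \<gamma>)"
    proof
      assume "\<forall>u \<in> ?L. ?semigroup u"
      then show "convolution_coef \<alpha> (c \<alpha>) \<gamma> (c \<gamma>) = c (\<alpha> + \<gamma>)"
        using one transfer[of "\<lambda>_. 1" "\<lambda>_. 1"] admissible \<alpha> \<gamma> \<alpha>\<gamma>
        by (intro convol_op_power_kernel_unique[of _ _ "\<alpha> + \<gamma>"] power_kernel_convolution(1)) auto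
    next
      assume eq: "convolution_coef \<alpha> (c \<alpha>) \<gamma> (c \<gamma>) = c (\<alpha> + \<gamma>)"
      show "\<forall>u \<in> ?L. ?semigroup u"
      proof
        fix u assume u: "u \<in> ?L"
        then have "u \<in> borel_measurable (lebesgue_on {a..b})" by (simp add: L1_weighted_def)
        then obtain v where "v \<in> borel_measurable borel" "AE t in lborel. t \<in> {a..b} \<longrightarrow> u t = v t"
          by (rule Borel_version)
        from transfer[OF u this] show "?semigroup u" by (simp add: eq)
      qed
    qed
    also have "\<dots> \<longleftrightarrow> ?coefs"
      unfolding fun_eq_iff c_def using twist_convolution_coef_iff[OF \<beta> \<alpha> \<gamma>] by blast
    finally show ?thesis .
  qed
  then show ?thesis by blast
qed

end
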